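(* For any topological space $X$ of countable tightness, each compact convex subset $\mathcal K\subset SC_p(X)$ (with the subspace topology) has weight $w(\mathcal K)\le\max\{hl(X),hd(X)\}$. Moreover, $$hl(X)\le\sup\{w(\mathcal K):\mathcal K\text{ is a compact convex subset of }SC_p(X)\}\le\max\{hl(X),hd(X)\}.$$
   Context: A function $f:X\to Y$ between topological spaces is scatteredly continuous if for each non-empty subspace $A\subset X$ the restriction $f|A:A\to Y$ has a point of continuity. $SC_p(X)\subset\mathbb R^X$ denotes the linear space of all scatteredly continuous real-valued functions on $X$, endowed with the topology of pointwise convergence. For a topological space $X$: the weight $w(X)$ is the smallest cardinality of a base of the topology of $X$; the Lindelöf number $l(X)$ is the smallest infinite cardinal $\kappa$ such that each open cover of $X$ has a subcover of cardinality $\le\kappa$; the hereditary Lindelöf number is $hl(X)=\sup\{l(Z):Z\subset X\}$; the density $d(X)$ is the smallest cardinality of a dense subset of $X$; the hereditary density is $hd(X)=\sup\{d(Z):Z\subset X\}$. The tightness $t(X)$ is the smallest infinite cardinal $\kappa$ such that for each subset $A\subset X$ and each point $a\in\bar A$ there is a subset $B\subset A$ of cardinality $|B|\le\kappa$ with $a\in\bar B$; $X$ has countable tightness if $t(X)=\aleph_0$.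
   Formalization: The lower bound hl(X) ≤ sup w(K) is stated only for non-empty X; for empty X it fails, since SC_p(X) is a single point, so the supremum is 1, while hl(X) is infinite by definition. Both upper bounds are stated for all X. *)

theory Defs
  imports "HOL-Analysis.Analysis"
begin

unbundle cardinal_syntax

section \<open>Least cardinals, suprema and maxima of cardinals\<close>

text \<open>
  Cardinals are cardinal orders \<^term>\<open>r :: 'b rel\<close>, determined only up to \<open>=o\<close>; they are
  compared, also across types, by \<open>\<le>o\<close>. If no cardinal on \<^typ>\<open>'b\<close> satisfies \<open>P\<close>,
  \<open>card_Least P\<close> is unspecified; below, \<open>P\<close> is always satisfiable
  (see the \<open>_least\<close> lemmas).
\<close>

definition is_card_Least :: "('b rel \<Rightarrow> bool) \<Rightarrow> 'b rel \<Rightarrow> bool" where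
  "is_card_Least P r \<longleftrightarrow> Card_order r \<and> P r \<and> (\<forall>s :: 'b rel. Card_order s \<and> P s \<longrightarrow> r \<le>o s)"

definition card_Least :: "('b rel \<Rightarrow> bool) \<Rightarrow> 'b rel" where
  "card_Least P = (SOME r. is_card_Least P r)"

definition card_Sup :: "'b rel set \<Rightarrow> 'b rel" where
  "card_Sup R = card_Least (\<lambda>s. \<forall>r\<in>R. r \<le>o s)"

definition card_max :: "'b rel \<Rightarrow> 'b rel \<Rightarrow> 'b rel" where
  "card_max r s = (if r \<le>o s then s else r)"

lemma card_Least_is_least:
  assumes "Card_order (s :: 'b rel)" "P s"
  shows "is_card_Least P (card_Least P)"
proof -
  let ?R = "{r :: 'b rel. Card_order r \<and> P r}"
  have "?R \<noteq> {}" using assms by blast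
  moreover have "\<forall>r\<in>?R. Card_order r" by blast
  ultimately have "\<exists>r\<in>?R. \<forall>s\<in>?R. r \<le>o s"
    by (rule exists_minim_Card_order)
  then have "\<exists>r. is_card_Least P r" by (auto simp: is_card_Least_def)
  then show ?thesis unfolding card_Least_def by (rule someI_ex)
qed

lemma Card_order_ordLeq_UNIV:
  assumes "Card_order (r :: 'b rel)" shows "r \<le>o |UNIV :: 'b set|"
  by (rule ordIso_ordLeq_trans[OF ordIso_symmetric[OF card_of_Field_ordIso[OF assms]]
        card_of_mono1[OF subset_UNIV]])

lemma card_Sup_least:
  assumes "\<And>r :: 'b rel. r \<in> R \<Longrightarrow> Card_order r"
  shows "is_card_Least (\<lambda>s. \<forall>r\<in>R. r \<le>o s) (card_Sup R)"
  unfolding card_Sup_def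
  by (rule card_Least_is_least[OF card_of_Card_order[of "UNIV :: 'b set"]])
    (simp add: assms Card_order_ordLeq_UNIV)

section \<open>Cardinal invariants of a topological space\<close>

text \<open>
  All invariants of a space on \<^typ>\<open>'a\<close> are cardinals on \<^typ>\<open>'a set + nat\<close>, which is large
  enough for families of the form \<^term>\<open>\<B> :: 'a set set\<close> and always infinite.
\<close>

type_synonym 'a cardinal = "('a set + nat) rel"

definition is_base :: "'a topology \<Rightarrow> 'a set set \<Rightarrow> bool" where
  "is_base X \<B> \<longleftrightarrow> (\<forall>V\<in>\<B>. openin X V) \<and>
     (\<forall>U x. openin X U \<and> x \<in> U \<longrightarrow> (\<exists>V\<in>\<B>. x \<in> V \<and> V \<subseteq> U))"

definition weight :: "'a topology \<Rightarrow> 'a cardinal" where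
  "weight X = card_Least (\<lambda>\<kappa>. \<exists>\<B>. is_base X \<B> \<and> |\<B>| =o \<kappa>)"

definition density :: "'a topology \<Rightarrow> 'a cardinal" where
  "density X = card_Least (\<lambda>\<kappa>. \<exists>D. D \<subseteq> topspace X \<and> X closure_of D = topspace X \<and> |D| =o \<kappa>)"

definition Lindelof_number :: "'a topology \<Rightarrow> 'a cardinal" where
  "Lindelof_number X = card_Least (\<lambda>\<kappa>. cinfinite \<kappa> \<and>
     (\<forall>\<U>. (\<forall>U\<in>\<U>. openin X U) \<and> \<Union>\<U> = topspace X \<longrightarrow>
        (\<exists>\<V>. \<V> \<subseteq> \<U> \<and> |\<V>| \<le>o \<kappa> \<and> \<Union>\<V> = topspace X)))"

definition tightness :: "'a topology \<Rightarrow> 'a cardinal" where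
  "tightness X = card_Least (\<lambda>\<kappa>. cinfinite \<kappa> \<and>
     (\<forall>A a. A \<subseteq> topspace X \<and> a \<in> X closure_of A \<longrightarrow>
        (\<exists>B. B \<subseteq> A \<and> |B| \<le>o \<kappa> \<and> a \<in> X closure_of B)))"

definition countable_tightness :: "'a topology \<Rightarrow> bool" where
  "countable_tightness X \<longleftrightarrow> tightness X =o natLeq"

definition hereditary_Lindelof_number :: "'a topology \<Rightarrow> 'a cardinal" where
  "hereditary_Lindelof_number X =
     card_Sup {Lindelof_number (subtopology X Z) | Z. Z \<subseteq> topspace X}"

definition hereditary_density :: "'a topology \<Rightarrow> 'a cardinal" where
  "hereditary_density X = card_Sup {density (subtopology X Z) | Z. Z \<subseteq> topspace X}"

lemma ordIso_cardinal_exists: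
  assumes "|A| \<le>o |UNIV :: ('a set + nat) set|"
  shows "\<exists>\<kappa> :: 'a cardinal. Card_order \<kappa> \<and> |A| =o \<kappa>"
proof -
  obtain f :: "_ \<Rightarrow> 'a set + nat" where f: "inj_on f A"
    using assms unfolding card_of_ordLeq[symmetric] by blast
  then have "|A| =o |f ` A|"
    using card_of_ordIso inj_on_imp_bij_betw by blast
  then show ?thesis using card_of_Card_order by blast
qed

lemma set_ordLeq_cardinal: "|\<B> :: 'a set set| \<le>o |UNIV :: ('a set + nat) set|"
  unfolding card_of_ordLeq[symmetric] by (rule exI[of _ Inl]) auto

lemma elem_ordLeq_cardinal: "|A :: 'a set| \<le>o |UNIV :: ('a set + nat) set|"
  unfolding card_of_ordLeq[symmetric]
  by (rule exI[of _ "\<lambda>x. Inl {x}"]) (auto simp: inj_on_def)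

lemma weight_least:
  "is_card_Least (\<lambda>\<kappa>. \<exists>\<B>. is_base X \<B> \<and> |\<B>| =o \<kappa>) (weight X)"
proof -
  have base: "is_base X {U. openin X U}" unfolding is_base_def by blast
  obtain \<kappa> :: "'a cardinal" where "Card_order \<kappa>" "|{U. openin X U}| =o \<kappa>"
    using ordIso_cardinal_exists[OF set_ordLeq_cardinal] by blast
  then show ?thesis
    unfolding weight_def using base by (intro card_Least_is_least[of \<kappa>] exI conjI)
qed

lemma density_least:
  "is_card_Least (\<lambda>\<kappa>. \<exists>D. D \<subseteq> topspace X \<and> X closure_of D = topspace X \<and> |D| =o \<kappa>) (density X)"
proof -
  have dense: "X closure_of topspace X = topspace X" by simp
  obtain \<kappa> :: "'a cardinal" where "Card_order \<kappa>" "|topspace X| =o \<kappa>"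
    using ordIso_cardinal_exists[OF elem_ordLeq_cardinal] by blast
  then show ?thesis
    unfolding density_def using dense
    by (intro card_Least_is_least[of \<kappa>] exI[of _ "topspace X"] conjI) auto
qed

lemma cinfinite_UNIV_cardinal: "cinfinite |UNIV :: ('a set + nat) set|"
  by (simp add: cinfinite_def Field_card_of)

lemma Lindelof_number_least:
  "is_card_Least (\<lambda>\<kappa>. cinfinite \<kappa> \<and>
     (\<forall>\<U>. (\<forall>U\<in>\<U>. openin X U) \<and> \<Union>\<U> = topspace X \<longrightarrow>
        (\<exists>\<V>. \<V> \<subseteq> \<U> \<and> |\<V>| \<le>o \<kappa> \<and> \<Union>\<V> = topspace X))) (Lindelof_number X)"
  unfolding Lindelof_number_def
proof (rule card_Least_is_least[OF card_of_Card_order[of "UNIV :: ('a set + nat) set"]],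
    intro conjI allI impI)
  show "cinfinite |UNIV :: ('a set + nat) set|" by (rule cinfinite_UNIV_cardinal)
next
  fix \<U> assume "(\<forall>U\<in>\<U>. openin X U) \<and> \<Union>\<U> = topspace X"
  then show "\<exists>\<V>. \<V> \<subseteq> \<U> \<and> |\<V>| \<le>o |UNIV :: ('a set + nat) set| \<and> \<Union>\<V> = topspace X"
    by (intro exI[of _ \<U>] conjI subset_refl set_ordLeq_cardinal) (rule conjunct2)
qed

lemma tightness_least:
  "is_card_Least (\<lambda>\<kappa>. cinfinite \<kappa> \<and>
     (\<forall>A a. A \<subseteq> topspace X \<and> a \<in> X closure_of A \<longrightarrow>
        (\<exists>B. B \<subseteq> A \<and> |B| \<le>o \<kappa> \<and> a \<in> X closure_of B))) (tightness X)"
  unfolding tightness_def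
proof (rule card_Least_is_least[OF card_of_Card_order[of "UNIV :: ('a set + nat) set"]],
    intro conjI allI impI)
  show "cinfinite |UNIV :: ('a set + nat) set|" by (rule cinfinite_UNIV_cardinal)
next
  fix A a assume "A \<subseteq> topspace X \<and> a \<in> X closure_of A"
  then show "\<exists>B. B \<subseteq> A \<and> |B| \<le>o |UNIV :: ('a set + nat) set| \<and> a \<in> X closure_of B"
    by (intro exI[of _ A] conjI subset_refl elem_ordLeq_cardinal) (rule conjunct2)
qed

lemma hereditary_Lindelof_number_least:
  "is_card_Least (\<lambda>s. \<forall>r\<in>{Lindelof_number (subtopology X Z) | Z. Z \<subseteq> topspace X}. r \<le>o s)
     (hereditary_Lindelof_number X)"
  unfolding hereditary_Lindelof_number_def
  by (rule card_Sup_least) (use Lindelof_number_least in \<open>auto simp: is_card_Least_def\<close>)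

lemma hereditary_density_least:
  "is_card_Least (\<lambda>s. \<forall>r\<in>{density (subtopology X Z) | Z. Z \<subseteq> topspace X}. r \<le>o s)
     (hereditary_density X)"
  unfolding hereditary_density_def
  by (rule card_Sup_least) (use density_least in \<open>auto simp: is_card_Least_def\<close>)

section \<open>Scatteredly continuous functions\<close>

definition scatteredly_continuous :: "'a topology \<Rightarrow> 'b topology \<Rightarrow> ('a \<Rightarrow> 'b) \<Rightarrow> bool" where
  "scatteredly_continuous X Y f \<longleftrightarrow> f \<in> topspace X \<rightarrow> topspace Y \<and>
     (\<forall>A. A \<subseteq> topspace X \<and> A \<noteq> {} \<longrightarrow> (\<exists>a\<in>A. topcontinuous_at (subtopology X A) Y f a))"

text \<open>
  Functions on the carrier of \<open>X\<close> are represented by the functions that are \<open>undefined\<close>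
  outside \<^term>\<open>topspace X\<close>, which is the carrier convention of \<^const>\<open>product_topology\<close>.
  Linear combinations are accordingly taken pointwise on \<^term>\<open>topspace X\<close>.
\<close>

definition SC_p :: "'a topology \<Rightarrow> ('a \<Rightarrow> real) topology" where
  "SC_p X = subtopology (powertop_real (topspace X))
     {f \<in> extensional (topspace X). scatteredly_continuous X euclideanreal f}"

definition convex_funs :: "'a set \<Rightarrow> ('a \<Rightarrow> real) set \<Rightarrow> bool" where
  "convex_funs S K \<longleftrightarrow> (\<forall>f\<in>K. \<forall>g\<in>K. \<forall>u\<ge>0. \<forall>v\<ge>0. u + v = 1 \<longrightarrow>
     (\<lambda>x\<in>S. u * f x + v * g x) \<in> K)"

definition compact_convex_SC :: "'a topology \<Rightarrow> ('a \<Rightarrow> real) set \<Rightarrow> bool" where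
  "compact_convex_SC X K \<longleftrightarrow> compactin (SC_p X) K \<and> convex_funs (topspace X) K"

lemma topspace_SC_p:
  "topspace (SC_p X) = {f \<in> extensional (topspace X). scatteredly_continuous X euclideanreal f}"
  by (auto simp: SC_p_def PiE_def)

lemma sup_weight_compact_convex_least:
  "is_card_Least (\<lambda>s. \<forall>r\<in>{weight (subtopology (SC_p X) K) | K. compact_convex_SC X K}. r \<le>o s)
     (card_Sup {weight (subtopology (SC_p X) K) | K. compact_convex_SC X K})"
  by (rule card_Sup_least) (use weight_least in \<open>auto simp: is_card_Least_def\<close>)

end

theory Submission
  imports Defs
begin

text \<open>
  Upper bound. Let \<open>\<kappa> = max (hl X) (hd X)\<close>. It suffices to find at most \<open>\<kappa>\<close> points on which every
  \<open>f \<in> K\<close> is determined: as \<open>K\<close> is compact, evaluation at these points yields a base. Since \<open>K\<close> is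
  pointwise bounded, \<open>X\<close> is the union of countably many sets on each of which \<open>K\<close> is uniformly
  bounded, and each of these sets can be treated separately. A non-empty subset \<open>A\<close> of such a set
  has a non-empty relatively open part at whose points every \<open>f \<in> K\<close> restricted to \<open>A\<close> is
  continuous. Otherwise countable tightness yields a countable \<open>Q \<subseteq> A\<close> such that each \<open>q \<in> Q\<close> is
  a discontinuity point of some member of \<open>K\<close> restricted to \<open>Q\<close>, and successive small convex
  perturbations converge to a member of \<open>K\<close> whose restriction to \<open>Q\<close> is nowhere continuous. On a
  relatively open part of continuity a dense set of at most \<open>\<kappa>\<close> points determines \<open>K\<close>, and by the
  hereditary Lindelof property at most \<open>\<kappa>\<close> such parts are needed.

  Lower bound. Well-order a family of open sets and let \<open>r x\<close> be its least member containing \<open>x\<close>.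
  Every function of \<open>r\<close> is scatteredly continuous, because \<open>r\<close> is constant on a relative
  neighbourhood of any point of \<open>A\<close> at which \<open>r\<close> is minimal. So the functions to \<open>[0, 1]\<close> that
  factor through \<open>r\<close> form a compact convex cube of weight at least the cardinality of the range of
  \<open>r\<close>, which is a subfamily with the same union.
\<close>

section \<open>Cardinal arithmetic\<close>

lemma is_card_Least_le:
  assumes "is_card_Least P r" "Card_order s" "P s"
  shows "r \<le>o s"
  using assms unfolding is_card_Least_def by blast

lemma card_max_upper:
  assumes "Card_order r" "Card_order s"
  shows "Card_order (card_max r s)" "r \<le>o card_max r s" "s \<le>o card_max r s"
proof -
  have wo: "Well_order r" "Well_order s" using assms card_order_on_well_order_on by blast+
  then show "Card_order (card_max r s)" "r \<le>o card_max r s" "s \<le>o card_max r s"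
    using assms ordLeq_total[OF wo] ordLeq_reflexive unfolding card_max_def by auto
qed

text \<open>\<open>card_Sup R\<close> is least only among cardinals on the type of \<open>R\<close>,
  while \<open>\<kappa>\<close> lives on another type. The embedding of types allows
  \<open>\<kappa>\<close> to be copied there first.\<close>

lemma card_Sup_le:
  fixes R :: "'b cardinal set" and \<kappa> :: "'a cardinal"
  assumes R: "\<And>r. r \<in> R \<Longrightarrow> Card_order r \<and> r \<le>o \<kappa>" and \<kappa>: "Card_order \<kappa>"
    and i: "|UNIV :: ('a set + nat) set| \<le>o |UNIV :: ('b set + nat) set|"
  shows "card_Sup R \<le>o \<kappa>"
proof -
  have "|Field \<kappa>| \<le>o |UNIV :: ('b set + nat) set|"
    using card_of_mono1[OF subset_UNIV] i by (rule ordLeq_transitive)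
  then obtain s :: "'b cardinal" where s: "Card_order s" "|Field \<kappa>| =o s"
    using ordIso_cardinal_exists by blast
  have \<kappa>s: "\<kappa> =o s" using ordIso_transitive[OF ordIso_symmetric[OF card_of_Field_ordIso[OF \<kappa>]] s(2)] .
  have "\<forall>r\<in>R. r \<le>o s" using R \<kappa>s ordLeq_ordIso_trans by blast
  moreover have "is_card_Least (\<lambda>s. \<forall>r\<in>R. r \<le>o s) (card_Sup R)"
    by (rule card_Sup_least) (use R in blast)
  ultimately have "card_Sup R \<le>o s" using s(1) unfolding is_card_Least_def by blast
  then show ?thesis by (rule ordLeq_ordIso_trans[OF _ ordIso_symmetric[OF \<kappa>s]])
qed

text \<open>Indicator functions of points embed \<open>'a\<close> into the real functions on it.
  This makes invariants of \<open>X\<close> comparable with weights of function spaces.\<close>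

lemma cardinal_type_le_fun: "|UNIV :: ('a set + nat) set| \<le>o |UNIV :: (('a \<Rightarrow> real) set + nat) set|"
proof -
  have "inj (map_sum (image (\<lambda>(x::'a) y. if y = x then 1 else 0 :: real)) (id :: nat \<Rightarrow> nat))"
  proof (intro sum.inj_map inj_on_id)
    have "inj (\<lambda>(x::'a) y. if y = x then 1 else 0 :: real)"
      by (rule injI) (metis zero_neq_one)
    then show "inj (image (\<lambda>(x::'a) y. if y = x then 1 else 0 :: real))"
      by (intro injI) (simp only: inj_image_eq_iff)
  qed
  then show ?thesis unfolding card_of_ordLeq[symmetric] by blast
qed

lemma countable_ordLeq_Cinfinite:
  assumes "countable A" "Cinfinite \<kappa>"
  shows "|A| \<le>o \<kappa>"
proof -
  have "|A| \<le>o |UNIV :: nat set|"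
    using assms(1) unfolding card_of_ordLeq[symmetric] countable_def by blast
  then show ?thesis
    using ordLeq_ordIso_trans[OF _ card_of_nat] natLeq_ordLeq_cinfinite[OF assms(2)] ordLeq_transitive
    by blast
qed

text \<open>By induction on the size: subsets with \<open>Suc n\<close> elements arise by adding one
  of at most \<kappa> elements to a subset with \<open>n\<close> elements.\<close>

lemma Fpow_ordLeq_Cinfinite:
  assumes A: "|A| \<le>o \<kappa>" and inf: "Cinfinite \<kappa>"
  shows "|Fpow A| \<le>o \<kappa>"
proof -
  define F where "F n = {B. B \<subseteq> A \<and> finite B \<and> card B = n}" for n
  have "|F n| \<le>o \<kappa>" for n
  proof (induction n)
    case 0
    have "F 0 \<subseteq> {{}}" unfolding F_def by auto
    then show ?case by (intro countable_ordLeq_Cinfinite inf) (auto intro: countable_subset)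
  next
    case (Suc n)
    have "F (Suc n) \<subseteq> (\<Union>a\<in>A. insert a ` F n)"
    proof
      fix B assume B: "B \<in> F (Suc n)"
      then obtain a B' where "B = insert a B'" "a \<notin> B'" "card B' = n"
        unfolding F_def by (auto simp: card_Suc_eq)
      then show "B \<in> (\<Union>a\<in>A. insert a ` F n)" using B unfolding F_def by auto
    qed
    moreover have "|\<Union>a\<in>A. insert a ` F n| \<le>o \<kappa>"
      by (intro UNION_Cinfinite_bound A inf ballI ordLeq_transitive[OF card_of_image Suc])
    ultimately show ?case using card_of_mono1 ordLeq_transitive by blast
  qed
  then have "|\<Union>n. F n| \<le>o \<kappa>"
    by (intro UNION_Cinfinite_bound countable_ordLeq_Cinfinite inf) auto
  moreover have "Fpow A = (\<Union>n. F n)" unfolding Fpow_def F_def by auto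
  ultimately show ?thesis by simp
qed

lemma Times_ordLeq_Cinfinite:
  assumes "|A| \<le>o \<kappa>" "|B| \<le>o \<kappa>" "Cinfinite \<kappa>"
  shows "|A \<times> B| \<le>o \<kappa>"
  using assms by (intro card_of_Times_ordLeq_infinite_Field) (auto simp: cinfinite_def)

section \<open>Discontinuity points relative to a subspace\<close>

text \<open>The points where the restriction of \<open>f\<close> to \<open>A\<close> is
  discontinuous with gap at least \<open>e\<close>, for positive \<open>e\<close>. The closure form
  lets countable tightness act directly on the set of witnesses.\<close>

definition jump :: "'a topology \<Rightarrow> 'a set \<Rightarrow> ('a \<Rightarrow> real) \<Rightarrow> real \<Rightarrow> 'a set" where
  "jump X A f e = {a \<in> A. a \<in> X closure_of {x \<in> A. e \<le> \<bar>f x - f a\<bar>}}"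

lemma mem_jump_iff:
  assumes "A \<subseteq> topspace X"
  shows "a \<in> jump X A f e \<longleftrightarrow>
    a \<in> A \<and> (\<forall>U. openin X U \<and> a \<in> U \<longrightarrow> (\<exists>x\<in>A \<inter> U. e \<le> \<bar>f x - f a\<bar>))"
  using assms unfolding jump_def in_closure_of by blast

lemma not_mem_jumpE:
  assumes "A \<subseteq> topspace X" "a \<in> A" "a \<notin> jump X A f e"
  obtains U where "openin X U" "a \<in> U" "\<forall>x\<in>A \<inter> U. \<bar>f x - f a\<bar> < e"
proof -
  have "\<exists>U. openin X U \<and> a \<in> U \<and> \<not> (\<exists>x\<in>A \<inter> U. e \<le> \<bar>f x - f a\<bar>)"
    using assms(2,3) unfolding mem_jump_iff[OF assms(1)] by blast
  then show ?thesis using that unfolding not_le[symmetric] by blast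
qed

lemma topcontinuous_at_iff_jump:
  fixes f :: "'a \<Rightarrow> real"
  assumes "A \<subseteq> topspace X" "a \<in> A"
  shows "topcontinuous_at (subtopology X A) euclideanreal f a \<longleftrightarrow> (\<forall>e>0. a \<notin> jump X A f e)"
proof
  assume c: "topcontinuous_at (subtopology X A) euclideanreal f a"
  show "\<forall>e>0. a \<notin> jump X A f e"
  proof (intro allI impI)
    fix e :: real assume e: "e > 0"
    have "openin euclideanreal (ball (f a) e)" "f a \<in> ball (f a) e" using e by auto
    then obtain U where U: "openin (subtopology X A) U" "a \<in> U" "\<forall>y\<in>U. f y \<in> ball (f a) e"
      using c unfolding topcontinuous_at_def by meson
    then obtain V where V: "openin X V" "U = V \<inter> A" unfolding openin_subtopology by blast
    have "\<bar>f y - f a\<bar> < e" if "y \<in> A \<inter> V" for y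
      using U(3) V(2) that by (auto simp: dist_real_def abs_minus_commute)
    then show "a \<notin> jump X A f e"
      unfolding mem_jump_iff[OF assms(1)] using V U(2) by (meson IntD1 not_less)
  qed
next
  assume c: "\<forall>e>0. a \<notin> jump X A f e"
  show "topcontinuous_at (subtopology X A) euclideanreal f a"
    unfolding topcontinuous_at_def
  proof (intro conjI allI impI)
    fix V assume V: "openin euclideanreal V \<and> f a \<in> V"
    then obtain e where e: "e > 0" "ball (f a) e \<subseteq> V"
      using open_contains_ball_eq[of V] by auto
    have "a \<notin> jump X A f e" using c e(1) by blast
    with assms obtain U where U: "openin X U" "a \<in> U"
        "\<forall>x\<in>A \<inter> U. \<bar>f x - f a\<bar> < e"
      by (rule not_mem_jumpE) blast
    show "\<exists>U. openin (subtopology X A) U \<and> a \<in> U \<and> (\<forall>y\<in>U. f y \<in> V)"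
    proof (intro exI[of _ "U \<inter> A"] conjI ballI)
      fix y assume "y \<in> U \<inter> A"
      then have "f y \<in> ball (f a) e" using U(3) by (auto simp: dist_real_def abs_minus_commute)
      then show "f y \<in> V" using e by blast
    qed (use U assms in \<open>auto simp: openin_subtopology\<close>)
  qed (use assms in auto)
qed

lemma scatteredly_continuous_iff_jump:
  fixes f :: "'a \<Rightarrow> real"
  shows "scatteredly_continuous X euclideanreal f \<longleftrightarrow>
    (\<forall>A. A \<subseteq> topspace X \<and> A \<noteq> {} \<longrightarrow> (\<exists>a\<in>A. \<forall>e>0. a \<notin> jump X A f e))"
  by (simp add: scatteredly_continuous_def topcontinuous_at_iff_jump cong: bex_cong conj_cong imp_cong)

text \<open>Points at which the family is continuous cannot witness the discontinuity at \<open>a\<close> alone: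
  near such a point \<open>f\<close> takes almost the same value on the dense set \<open>D\<close>.\<close>

lemma jump_dense_discontinuities:
  assumes A: "A \<subseteq> topspace X" and e: "e > 0" and f: "f \<in> K" and a: "a \<in> jump X A f e"
    and D: "D = {x \<in> A. \<exists>g\<in>K. \<exists>e>0. x \<in> jump X A g e}"
    and dense: "A \<subseteq> X closure_of D"
  shows "a \<in> jump X D f (e / 2)"
proof -
  have DA: "D \<subseteq> topspace X" "D \<subseteq> A" using D A by auto
  have aD: "a \<in> D" using D a f e unfolding jump_def by blast
  have "\<exists>x\<in>D \<inter> U. e / 2 \<le> \<bar>f x - f a\<bar>" if U: "openin X U" "a \<in> U" for U
  proof -
    obtain x where x: "x \<in> A" "x \<in> U" "e \<le> \<bar>f x - f a\<bar>"
      using a U unfolding mem_jump_iff[OF A] by blast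
    show ?thesis
    proof (cases "x \<in> D")
      case True
      then show ?thesis using x e by (intro bexI[of _ x]) auto
    next
      case False
      then have "x \<notin> jump X A f (e / 2)" using D f e x(1) half_gt_zero by blast
      with A x(1) obtain V where V: "openin X V" "x \<in> V"
          "\<forall>y\<in>A \<inter> V. \<bar>f y - f x\<bar> < e / 2"
        by (rule not_mem_jumpE) blast
      have "x \<in> X closure_of D" using dense x(1) by blast
      moreover have "openin X (U \<inter> V)" "x \<in> U \<inter> V" using U V x by auto
      ultimately obtain d where d: "d \<in> D" "d \<in> U \<inter> V"
        unfolding in_closure_of by blast
      then have "\<bar>f d - f x\<bar> < e / 2" using V DA by blast
      then have "e / 2 \<le> \<bar>f d - f a\<bar>" using x(3) by linarith
      then show ?thesis using d by blast
    qed
  qed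
  then show ?thesis unfolding mem_jump_iff[OF DA(1)] using aD by blast
qed

section \<open>Reduction to a countable set\<close>

lemma countable_tightness_closure:
  assumes "countable_tightness X" "A \<subseteq> topspace X" "a \<in> X closure_of A"
  obtains B where "B \<subseteq> A" "countable B" "a \<in> X closure_of B"
proof -
  have "\<exists>B. B \<subseteq> A \<and> |B| \<le>o tightness X \<and> a \<in> X closure_of B"
    using tightness_least[of X] assms(2,3) unfolding is_card_Least_def by blast
  then obtain B where B: "B \<subseteq> A" "|B| \<le>o tightness X" "a \<in> X closure_of B" by blast
  have "|B| \<le>o |UNIV :: nat set|"
    using ordLeq_ordIso_trans[OF ordLeq_ordIso_trans[OF B(2) assms(1)[unfolded countable_tightness_def]]
        ordIso_symmetric[OF card_of_nat]] .
  then have "countable B" unfolding card_of_ordLeq[symmetric] countable_def by blast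
  then show ?thesis using that B by blast
qed

text \<open>A closing-off argument: tightness gives each point of \<open>D\<close> a countable set
  \<open>B a\<close> of witnesses for its discontinuity, and a countable set closed under
  \<open>B\<close> retains the discontinuities of all its points.\<close>

lemma countable_jump_set:
  assumes ct: "countable_tightness X" and D: "D \<subseteq> topspace X" "D \<noteq> {}"
    and jump: "\<And>a. a \<in> D \<Longrightarrow> \<exists>f\<in>K. \<exists>e>0. a \<in> jump X D f e"
  obtains Q where "countable Q" "Q \<noteq> {}" "Q \<subseteq> D" "\<forall>q\<in>Q. \<exists>f\<in>K. \<exists>e>0. q \<in> jump X Q f e"
proof -
  have "\<exists>B. B \<subseteq> D \<and> countable B \<and> a \<in> X closure_of B \<and>
      (\<exists>f\<in>K. \<exists>e>0. \<forall>x\<in>B. e \<le> \<bar>f x - f a\<bar>)" if a: "a \<in> D" for a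
  proof -
    obtain f e where fe: "f \<in> K" "e > 0" "a \<in> X closure_of {x \<in> D. e \<le> \<bar>f x - f a\<bar>}"
      using jump[OF a] unfolding jump_def by blast
    obtain B where "B \<subseteq> {x \<in> D. e \<le> \<bar>f x - f a\<bar>}" "countable B" "a \<in> X closure_of B"
      by (rule countable_tightness_closure[OF ct _ fe(3)]) (use D in auto)
    then show ?thesis using fe by blast
  qed
  then have "\<forall>a\<in>D. \<exists>B. B \<subseteq> D \<and> countable B \<and> a \<in> X closure_of B \<and>
      (\<exists>f\<in>K. \<exists>e>0. \<forall>x\<in>B. e \<le> \<bar>f x - f a\<bar>)" by blast
  from bchoice[OF this] obtain B where "\<forall>a\<in>D. B a \<subseteq> D \<and> countable (B a) \<and>
      a \<in> X closure_of B a \<and> (\<exists>f\<in>K. \<exists>e>0. \<forall>x\<in>B a. e \<le> \<bar>f x - f a\<bar>)" ..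
  then have B: "B a \<subseteq> D" "countable (B a)" "a \<in> X closure_of B a"
      "\<exists>f\<in>K. \<exists>e>0. \<forall>x\<in>B a. e \<le> \<bar>f x - f a\<bar>" if "a \<in> D" for a
    using that by blast+
  obtain a0 where a0: "a0 \<in> D" using D by blast
  \<comment> \<open>Start from one point and repeatedly adjoin the witnesses of all points
    present.\<close>
  define Q where "Q n = ((\<lambda>S. S \<union> (\<Union>a\<in>S. B a)) ^^ n) {a0}" for n
  have Q_Suc: "Q (Suc n) = Q n \<union> (\<Union>a\<in>Q n. B a)" for n by (simp add: Q_def)
  have Q0: "Q 0 = {a0}" by (simp add: Q_def)
  have Qn: "Q n \<subseteq> D \<and> countable (Q n)" for n
  proof (induction n)
    case 0
    then show ?case using a0 Q0 by simp
  next
    case (Suc n)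
    have "\<forall>a\<in>Q n. B a \<subseteq> D \<and> countable (B a)" using Suc B by blast
    then show ?case using Suc unfolding Q_Suc by blast
  qed
  let ?Q = "\<Union>n. Q n"
  have "\<exists>g\<in>K. \<exists>d>0. q \<in> jump X ?Q g d" if q: "q \<in> ?Q" for q
  proof -
    have qD: "q \<in> D" using q Qn by blast
    obtain n where "q \<in> Q n" using q by blast
    \<comment> \<open>Witnesses of a point of stage \<open>n\<close> enter at stage
      \<open>Suc n\<close>, so the union is closed under \<open>B\<close>.\<close>
    then have "B q \<subseteq> Q (Suc n)" unfolding Q_Suc by blast
    then have BQ: "B q \<subseteq> ?Q" by blast
    obtain f e where fe: "f \<in> K" "e > 0" "\<forall>x\<in>B q. e \<le> \<bar>f x - f q\<bar>" using B(4)[OF qD] by blast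
    then have "B q \<subseteq> {x \<in> ?Q. e \<le> \<bar>f x - f q\<bar>}" using BQ by blast
    then have "q \<in> X closure_of {x \<in> ?Q. e \<le> \<bar>f x - f q\<bar>}"
      using B(3)[OF qD] closure_of_mono by blast
    then show ?thesis using fe q unfolding jump_def by blast
  qed
  then have "\<forall>q\<in>?Q. \<exists>g\<in>K. \<exists>d>0. q \<in> jump X ?Q g d" by (rule ballI)
  moreover have "countable ?Q" using Qn by blast
  moreover have "?Q \<noteq> {}" using Q0 by blast
  moreover have "?Q \<subseteq> D" using Qn by blast
  ultimately show ?thesis by (rule that[rotated 3])
qed

section \<open>Perturbation inside a compact convex set\<close>

text \<open>The errors at \<open>x\<close> and at \<open>q\<close> together cost at most half of the
  gap.\<close>

lemma jump_perturb:
  assumes Q: "Q \<subseteq> topspace X" and q: "q \<in> jump X Q g e"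
    and h: "\<And>x. x \<in> Q \<Longrightarrow> \<bar>h x - g x\<bar> \<le> e / 4"
  shows "q \<in> jump X Q h (e / 2)"
proof -
  have qQ: "q \<in> Q" using q unfolding jump_def by blast
  have "e / 2 \<le> \<bar>h x - h q\<bar>" if "x \<in> Q" "e \<le> \<bar>g x - g q\<bar>" for x
    using h[OF that(1)] h[OF qQ] that(2) by linarith
  then show ?thesis using q unfolding mem_jump_iff[OF Q] by blast
qed

text \<open>Since \<open>g\<close> is continuous at \<open>q\<close> relative to \<open>Q\<close>,
  its share varies by at most \<open>s * e / 2\<close> near \<open>q\<close>, which cannot cancel
  the gap of at least \<open>s * e\<close> contributed by \<open>f\<close>.\<close>

lemma jump_convex_combination:
  assumes Q: "Q \<subseteq> topspace X" and q: "q \<in> jump X Q f e" and s: "s > 0" "e > 0" "s \<le> 1"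
    and g: "\<And>d. d > 0 \<Longrightarrow> q \<notin> jump X Q g d"
    and h: "\<And>x. x \<in> Q \<Longrightarrow> h x = (1 - s) * g x + s * f x"
  shows "q \<in> jump X Q h (s * e / 2)"
proof -
  have qQ: "q \<in> Q" using q unfolding jump_def by blast
  have "s * e / 2 > 0" using s by simp
  then have "q \<notin> jump X Q g (s * e / 2)" by (rule g)
  with Q qQ obtain V where V: "openin X V" "q \<in> V"
      "\<forall>x\<in>Q \<inter> V. \<bar>g x - g q\<bar> < s * e / 2"
    by (rule not_mem_jumpE) blast
  have "\<exists>x\<in>Q \<inter> U. s * e / 2 \<le> \<bar>h x - h q\<bar>" if U: "openin X U" "q \<in> U" for U
  proof -
    have "openin X (U \<inter> V)" "q \<in> U \<inter> V" using U V by auto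
    then obtain x where x: "x \<in> Q" "x \<in> U \<inter> V" "e \<le> \<bar>f x - f q\<bar>"
      using q unfolding mem_jump_iff[OF Q] by blast
    have "h x - h q = (1 - s) * (g x - g q) + s * (f x - f q)"
      using h[OF x(1)] h[OF qQ] by (simp add: algebra_simps)
    moreover have "\<bar>(1 - s) * (g x - g q)\<bar> \<le> s * e / 2"
    proof -
      have "\<bar>(1 - s) * (g x - g q)\<bar> \<le> 1 * \<bar>g x - g q\<bar>"
        unfolding abs_mult using s by (intro mult_right_mono) auto
      then show ?thesis using bspec[OF V(3), of x] x by simp
    qed
    moreover have "s * e \<le> \<bar>s * (f x - f q)\<bar>"
      using x(3) s by (simp add: abs_mult)
    ultimately have "s * e / 2 \<le> \<bar>h x - h q\<bar>" by linarith
    then show ?thesis using x by blast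
  qed
  then show ?thesis unfolding mem_jump_iff[OF Q] using qQ by blast
qed

text \<open>One step of the inductive construction: \<open>g'\<close> is discontinuous at
  \<open>q\<close>, and the ball of radius \<open>r'\<close> about it lies inside the ball of radius
  \<open>r\<close> about \<open>g\<close> and is so small that the discontinuity survives throughout
  it.\<close>

lemma jump_stable_perturbation:
  assumes Q: "Q \<subseteq> topspace X" and conv: "convex_funs (topspace X) K"
    and bound: "\<forall>f\<in>K. \<forall>x\<in>Q. \<bar>f x\<bar> \<le> C"
    and g: "g \<in> K" and r: "r > 0" and q: "\<exists>f\<in>K. \<exists>e>0. q \<in> jump X Q f e"
  obtains g' r' where "g' \<in> K" "r' > 0"
    "\<forall>h x. \<bar>h x - g' x\<bar> \<le> r' \<longrightarrow> x \<in> Q \<longrightarrow> \<bar>h x - g x\<bar> \<le> r"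
    "\<forall>h. (\<forall>x\<in>Q. \<bar>h x - g' x\<bar> \<le> r') \<longrightarrow> (\<exists>e>0. q \<in> jump X Q h e)"
proof -
  have "\<exists>g'\<in>K. (\<forall>x\<in>Q. \<bar>g' x - g x\<bar> \<le> r / 2) \<and> (\<exists>d>0. q \<in> jump X Q g' d)"
  proof (cases "\<exists>d>0. q \<in> jump X Q g d")
    case True
    then show ?thesis using g r by (intro bexI[of _ g]) auto
  next
    case False
    obtain f e where f: "f \<in> K" "e > 0" "q \<in> jump X Q f e" using q by blast
    then have qQ: "q \<in> Q" unfolding jump_def by blast
    then have C: "C \<ge> 0" using bound g abs_ge_zero order_trans by blast
    \<comment> \<open>On \<open>Q\<close> the distance between \<open>f\<close> and \<open>g\<close>
      is at most \<open>2 * C\<close>, so this weight moves \<open>g\<close> by at most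
      \<open>r / 2\<close>. The summand 1 keeps the denominator positive.\<close>
    define s where "s = min 1 (r / (4 * (C + 1)))"
    have s: "s > 0" "s \<le> 1" using r C unfolding s_def by auto
    have sC: "s * (2 * C) \<le> r / 2"
    proof -
      have "s * (2 * C) \<le> r / (4 * (C + 1)) * (2 * (C + 1))"
        using C r s by (intro mult_mono) (auto simp: s_def)
      also have "\<dots> = r / 2" using C by (simp add: field_simps)
      finally show ?thesis .
    qed
    let ?h = "\<lambda>x\<in>topspace X. (1 - s) * g x + s * f x"
    have "?h \<in> K" using conv g f(1) s unfolding convex_funs_def by (auto simp del: restrict_apply)
    moreover have "\<bar>?h x - g x\<bar> \<le> r / 2" if "x \<in> Q" for x
    proof -
      have "?h x - g x = s * (f x - g x)" using that Q by (auto simp: algebra_simps)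
      then have "\<bar>?h x - g x\<bar> = s * \<bar>f x - g x\<bar>" using s by (simp del: restrict_apply add: abs_mult)
      also have "\<dots> \<le> s * (2 * C)"
        using bspec[OF bspec[OF bound f(1)] that] bspec[OF bspec[OF bound g] that] s
          by (intro mult_left_mono) linarith+
      finally show ?thesis using sC by linarith
    qed
    moreover have "q \<in> jump X Q ?h (s * e / 2)"
      by (rule jump_convex_combination[OF Q f(3) s(1) f(2) s(2), of g]) (use False Q in auto)
    moreover have "s * e / 2 > 0" using s f by simp
    ultimately show ?thesis by blast
  qed
  then obtain g' d where g': "g' \<in> K" "\<And>x. x \<in> Q \<Longrightarrow> \<bar>g' x - g x\<bar> \<le> r / 2" "d > 0" "q \<in> jump X Q g' d"
    by blast
  show ?thesis
  \<comment> \<open>The bound \<open>r / 2\<close> nests the balls, and \<open>d / 4\<close> is the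
    tolerance of \<open>jump_perturb\<close>.\<close>
  proof (rule that[of g' "min (r / 2) (d / 4)"])
    show "\<forall>h. (\<forall>x\<in>Q. \<bar>h x - g' x\<bar> \<le> min (r / 2) (d / 4)) \<longrightarrow> (\<exists>e>0. q \<in> jump X Q h e)"
    proof (intro allI impI)
      fix h assume "\<forall>x\<in>Q. \<bar>h x - g' x\<bar> \<le> min (r / 2) (d / 4)"
      then have "q \<in> jump X Q h (d / 2)" by (intro jump_perturb[OF Q g'(4)]) auto
      then show "\<exists>e>0. q \<in> jump X Q h e" using g'(3) half_gt_zero by blast
    qed
    show "\<forall>h x. \<bar>h x - g' x\<bar> \<le> min (r / 2) (d / 4) \<longrightarrow> x \<in> Q \<longrightarrow> \<bar>h x - g x\<bar> \<le> r"
    proof (intro allI impI)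
      fix h x assume "\<bar>h x - g' x\<bar> \<le> min (r / 2) (d / 4)" "x \<in> Q"
      then show "\<bar>h x - g x\<bar> \<le> r" using g'(2)[of x] by linarith
    qed
  qed (use g' r in auto)
qed

lemma continuous_map_eval:
  assumes "K \<subseteq> topspace (powertop_real S)" "x \<in> S"
  shows "continuous_map (subtopology (powertop_real S) K) euclideanreal (\<lambda>f. f x)"
  by (intro continuous_map_from_subtopology continuous_map_product_projection assms(2))

text \<open>Stage \<open>n\<close> makes \<open>q n\<close> a permanent discontinuity. The balls,
  taken uniformly over \<open>Q\<close>, are nested closed subsets of the compact \<open>K\<close>,
  so some member of \<open>K\<close> lies in all of them.\<close>

lemma nowhere_continuous_member:
  assumes Q: "Q \<subseteq> topspace X" "countable Q" "Q \<noteq> {}"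
    and comp: "compactin (powertop_real (topspace X)) K" and conv: "convex_funs (topspace X) K"
    and bound: "\<forall>f\<in>K. \<forall>x\<in>Q. \<bar>f x\<bar> \<le> C"
    and jump: "\<forall>q\<in>Q. \<exists>f\<in>K. \<exists>e>0. q \<in> jump X Q f e"
  obtains g where "g \<in> K" "\<forall>q\<in>Q. \<exists>e>0. q \<in> jump X Q g e"
proof -
  \<comment> \<open>The enumeration repeats points if \<open>Q\<close> is finite, which does no
    harm.\<close>
  define q where "q = from_nat_into Q"
  have q: "q n \<in> Q" "range q = Q" for n
    using Q from_nat_into[of Q] range_from_nat_into[of Q] unfolding q_def by auto
  \<comment> \<open>A state of the recursion is a function in \<open>K\<close> paired with a radius;
    \<open>?R n\<close> is the passage that settles \<open>q n\<close>.\<close>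
  let ?P = "\<lambda>(n::nat) p. fst p \<in> K \<and> snd p > (0::real)"
  let ?R = "\<lambda>n p p'.
      (\<forall>h x. \<bar>h x - fst p' x\<bar> \<le> snd p' \<longrightarrow> x \<in> Q \<longrightarrow> \<bar>h x - fst p x\<bar> \<le> snd p) \<and>
      (\<forall>h. (\<forall>x\<in>Q. \<bar>h x - fst p' x\<bar> \<le> snd p') \<longrightarrow> (\<exists>e>0. q n \<in> jump X Q h e))"
  have "\<exists>p. \<forall>n. ?P n (p n) \<and> ?R n (p n) (p (Suc n))"
  proof (rule dependent_nat_choice[where P = ?P and Q = ?R])
    obtain g where "g \<in> K" using jump Q by blast
    then show "\<exists>p. ?P 0 p" by (intro exI[of _ "(g, 1)"]) auto
  next
    fix p and n assume "?P n p"
    then have p: "fst p \<in> K" "snd p > 0" by auto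
    obtain g' r' where "g' \<in> K" "r' > 0"
      "\<forall>h x. \<bar>h x - g' x\<bar> \<le> r' \<longrightarrow> x \<in> Q \<longrightarrow> \<bar>h x - fst p x\<bar> \<le> snd p"
      "\<forall>h. (\<forall>x\<in>Q. \<bar>h x - g' x\<bar> \<le> r') \<longrightarrow> (\<exists>e>0. q n \<in> jump X Q h e)"
      by (rule jump_stable_perturbation[OF Q(1) conv bound p bspec[OF jump q(1), of n]]) blast+
    then show "\<exists>p'. ?P (Suc n) p' \<and> ?R n p p'"
      by (intro exI[of _ "(g', r')"]) simp
  qed
  then obtain p where p: "\<And>n. ?P n (p n)" "\<And>n. ?R n (p n) (p (Suc n))" by blast
  define g r where "g n = fst (p n)" and "r n = snd (p n)" for n
  have gr: "g n \<in> K" "r n > 0"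
    "\<And>h x. \<bar>h x - g (Suc n) x\<bar> \<le> r (Suc n) \<Longrightarrow> x \<in> Q \<Longrightarrow> \<bar>h x - g n x\<bar> \<le> r n"
    "\<And>h. (\<And>x. x \<in> Q \<Longrightarrow> \<bar>h x - g (Suc n) x\<bar> \<le> r (Suc n)) \<Longrightarrow> \<exists>e>0. q n \<in> jump X Q h e" for n
    using p[of n] unfolding g_def r_def by simp_all
  let ?Y = "subtopology (powertop_real (topspace X)) K"
  have Ksub: "K \<subseteq> topspace (powertop_real (topspace X))" using comp compactin_subset_topspace by blast
  then have tY: "topspace ?Y = K" by auto
  define C where "C n = {h \<in> K. \<forall>x\<in>Q. \<bar>h x - g n x\<bar> \<le> r n}" for n
  have "(\<Inter>n. C n) \<noteq> {}"
  proof (rule compact_space_imp_nest)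
    show "compact_space ?Y" using comp by (simp add: compactin_subspace)
    show "C n \<noteq> {}" for n using gr(1,2)[of n] less_imp_le unfolding C_def by fastforce
    show "decseq C" using gr(3) unfolding decseq_Suc_iff C_def by blast
    fix n
    have "closedin ?Y {h \<in> topspace ?Y. h x \<in> {g n x - r n..g n x + r n}}" if "x \<in> Q" for x
      by (rule closedin_continuous_map_preimage[OF continuous_map_eval[OF Ksub]]) (use that Q in auto)
    \<comment> \<open>A uniform bound over \<open>Q\<close> is an intersection of pointwise
      conditions, hence closed in the pointwise topology.\<close>
    moreover have "C n = (\<Inter>x\<in>Q. {h \<in> topspace ?Y. h x \<in> {g n x - r n..g n x + r n}})"
      using Q(3) unfolding C_def tY by (auto simp: abs_le_iff algebra_simps)
    ultimately show "closedin ?Y (C n)" using Q(3) by (auto intro: closedin_INT)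
  qed
  then obtain h where h: "\<And>n. h \<in> C n" by blast
  \<comment> \<open>The point \<open>q n\<close> is protected by the ball of the following stage,
    hence the index \<open>Suc n\<close> below.\<close>
  have "\<exists>e>0. q n \<in> jump X Q h e" for n
    using h[of "Suc n"] by (intro gr(4)) (auto simp: C_def)
  then have "\<forall>x\<in>Q. \<exists>e>0. x \<in> jump X Q h e" using q(2) by blast
  moreover have "h \<in> K" using h[of 0] by (auto simp: C_def)
  ultimately show ?thesis using that by simp
qed

text \<open>Otherwise the discontinuity points of members of \<open>K\<close> are dense in
  \<open>A\<close>. Passing to them and then to a countable subset keeps every point a
  discontinuity, and a single member of \<open>K\<close> discontinuous at all points of that subset
  results.\<close>

lemma common_continuity_piece:
  assumes ct: "countable_tightness X" and A: "A \<subseteq> topspace X" "A \<noteq> {}"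
    and comp: "compactin (powertop_real (topspace X)) K" and conv: "convex_funs (topspace X) K"
    and SC: "\<And>f. f \<in> K \<Longrightarrow> scatteredly_continuous X euclideanreal f"
    and bound: "\<forall>f\<in>K. \<forall>x\<in>A. \<bar>f x\<bar> \<le> C"
  obtains U where "openin X U" "A \<inter> U \<noteq> {}"
    "\<And>f a e. f \<in> K \<Longrightarrow> a \<in> A \<inter> U \<Longrightarrow> e > 0 \<Longrightarrow> a \<notin> jump X A f e"
proof (rule ccontr)
  assume "\<not> thesis"
  with that have neg: "\<And>U. openin X U \<Longrightarrow> A \<inter> U \<noteq> {} \<Longrightarrow> \<exists>f\<in>K. \<exists>a\<in>A \<inter> U. \<exists>e>0. a \<in> jump X A f e"
    by blast
  define D where "D = {x \<in> A. \<exists>g\<in>K. \<exists>e>0. x \<in> jump X A g e}"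
  have DA: "D \<subseteq> A" unfolding D_def by blast
  have dense: "A \<subseteq> X closure_of D"
  proof
    fix a assume a: "a \<in> A"
    have "\<exists>y. y \<in> D \<and> y \<in> U" if "a \<in> U" "openin X U" for U
      using neg[OF that(2)] that a unfolding D_def by blast
    then show "a \<in> X closure_of D" unfolding in_closure_of using a A by blast
  qed
  then have "D \<noteq> {}" using A(2) by auto
  moreover have disc: "\<exists>f\<in>K. \<exists>e>0. a \<in> jump X D f e" if a: "a \<in> D" for a
  proof -
    obtain g e where g: "g \<in> K" "e > 0" "a \<in> jump X A g e" using a unfolding D_def by blast
    have "a \<in> jump X D g (e / 2)"
      by (rule jump_dense_discontinuities[OF A(1) g(2,1,3) D_def dense])
    then show ?thesis using g half_gt_zero by blast
  qed
  moreover have "D \<subseteq> topspace X" using DA A by blast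
  ultimately obtain Q where Q: "countable Q" "Q \<noteq> {}" "Q \<subseteq> D"
      "\<forall>q\<in>Q. \<exists>f\<in>K. \<exists>e>0. q \<in> jump X Q f e"
    using countable_jump_set[OF ct, of D K] by metis
  have QX: "Q \<subseteq> topspace X" using Q DA A by blast
  have "\<forall>f\<in>K. \<forall>x\<in>Q. \<bar>f x\<bar> \<le> C" using Q(3) DA bound by blast
  then obtain g where g: "g \<in> K" "\<forall>q\<in>Q. \<exists>e>0. q \<in> jump X Q g e"
    using nowhere_continuous_member[OF QX Q(1,2) comp conv _ Q(4)] by blast
  \<comment> \<open>Scattered continuity of \<open>g\<close> is tested on the subspace
    \<open>Q\<close> itself.\<close>
  have "\<exists>q\<in>Q. \<forall>e>0. q \<notin> jump X Q g e"
    using SC[OF g(1)] Q(2) QX unfolding scatteredly_continuous_iff_jump by simp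
  then show False using g(2) by blast
qed

section \<open>Sets of points that determine the functions\<close>

definition determining :: "('a \<Rightarrow> real) set \<Rightarrow> 'a set \<Rightarrow> 'a set \<Rightarrow> bool" where
  "determining K D S \<longleftrightarrow> D \<subseteq> S \<and> (\<forall>f\<in>K. \<forall>g\<in>K. (\<forall>x\<in>D. f x = g x) \<longrightarrow> (\<forall>x\<in>S. f x = g x))"

lemma determiningD:
  assumes det: "determining K D S" and fg: "f \<in> K" "g \<in> K" "\<forall>x\<in>D. f x = g x" and x: "x \<in> S"
  shows "f x = g x"
proof -
  have "\<forall>f\<in>K. \<forall>g\<in>K. (\<forall>x\<in>D. f x = g x) \<longrightarrow> (\<forall>x\<in>S. f x = g x)"
    using det unfolding determining_def by (rule conjunct2)
  from mp[OF bspec[OF bspec[OF this fg(1)] fg(2)] fg(3)] x show ?thesis by (rule bspec)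
qed

lemma determining_UN:
  assumes "\<And>i. i \<in> I \<Longrightarrow> determining K (D i) (S i)"
  shows "determining K (\<Union>i\<in>I. D i) (\<Union>i\<in>I. S i)"
  unfolding determining_def
proof (intro conjI ballI impI)
  show "(\<Union>i\<in>I. D i) \<subseteq> (\<Union>i\<in>I. S i)"
    using assms unfolding determining_def by (intro UN_mono) auto
next
  fix f g x assume fg: "f \<in> K" "g \<in> K" "\<forall>x\<in>\<Union>i\<in>I. D i. f x = g x" and "x \<in> (\<Union>i\<in>I. S i)"
  then obtain i where i: "i \<in> I" "x \<in> S i" by blast
  then have "\<forall>x\<in>D i. f x = g x" using fg(3) by blast
  then show "f x = g x" using assms[OF i(1)] fg(1,2) i(2) unfolding determining_def by simp
qed

lemma determining_Un:
  assumes "determining K D S" "determining K D' S'"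
  shows "determining K (D \<union> D') (S \<union> S')"
  using assms unfolding determining_def by (simp add: ball_Un le_supI1 le_supI2)

section \<open>Weight of compact sets of functions\<close>

lemma weight_le:
  fixes Y :: "'b topology" and \<kappa> :: "'c rel"
  assumes "is_base Y \<B>" "|\<B>| \<le>o \<kappa>"
  shows "weight Y \<le>o \<kappa>"
proof -
  obtain s :: "'b cardinal" where s: "Card_order s" "|\<B>| =o s"
    using ordIso_cardinal_exists[OF set_ordLeq_cardinal] by blast
  then have "weight Y \<le>o s" using weight_least[of Y] assms(1) unfolding is_card_Least_def by blast
  also have "s \<le>o \<kappa>" using ordIso_ordLeq_trans[OF ordIso_symmetric[OF s(2)] assms(2)] .
  finally (ordLeq_transitive) show ?thesis .
qed

lemma weight_base:
  obtains \<B> where "is_base Y \<B>" "|\<B>| =o weight Y"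
  using weight_least[of Y] unfolding is_card_Least_def by blast

text \<open>A compact topology is determined by any point-separating family of continuous functions:
  for \<open>f d < p < g d\<close> the half-spaces cut out at \<open>(d, p)\<close> separate \<open>f\<close> from \<open>g\<close>.\<close>

lemma compact_separated_weight_le:
  fixes K :: "('a \<Rightarrow> real) set" and \<kappa> :: "'c rel"
  assumes comp: "compactin (powertop_real S) K" and D: "D \<subseteq> S"
    and sep: "\<And>f g. f \<in> K \<Longrightarrow> g \<in> K \<Longrightarrow> \<forall>x\<in>D. f x = g x \<Longrightarrow> f = g"
    and card: "|D| \<le>o \<kappa>" and inf: "Cinfinite \<kappa>"
  shows "weight (subtopology (powertop_real S) K) \<le>o \<kappa>"
proof -
  let ?Y = "subtopology (powertop_real S) K"
  have Ksub: "K \<subseteq> topspace (powertop_real S)" using comp compactin_subset_topspace by blast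
  then have tY: "topspace ?Y = K" by auto
  have compY: "compact_space ?Y" using comp by (simp add: compactin_subspace)
  define H where "H = (\<lambda>(d, p :: rat, b). {h \<in> K. if b then h d < of_rat p else of_rat p < h d})"
  define I where "I = D \<times> (UNIV :: rat set) \<times> (UNIV :: bool set)"
  have H: "openin ?Y (H i)" if iI: "i \<in> I" for i
  proof -
    obtain d p b where i: "i = (d, p, b)" "d \<in> D" using iI unfolding I_def by auto
    have "openin ?Y {h \<in> topspace ?Y. h d \<in> (if b then {..<of_rat p} else {of_rat p<..})}"
      by (rule openin_continuous_map_preimage[of _ euclideanreal])
        (use D i in \<open>auto intro: continuous_map_from_subtopology continuous_map_product_projection\<close>)
    then show ?thesis unfolding tY H_def i by (cases b) (simp_all add: lessThan_def greaterThan_def)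
  qed
  \<comment> \<open>Finite intersections of half-spaces with rational thresholds; the empty
    intersection gives \<open>K\<close>.\<close>
  define \<B> where "\<B> = (\<lambda>F. K \<inter> (\<Inter>i\<in>F. H i)) ` Fpow I"
  have opI: "openin ?Y (K \<inter> (\<Inter>i\<in>F. H i))" if "F \<in> Fpow I" for F
  proof -
    have "finite F" "\<forall>i\<in>F. openin ?Y (H i)" using that H unfolding Fpow_def by auto
    then have "openin ?Y (topspace ?Y \<inter> \<Inter>(H ` F))" by (intro openin_Int_Inter openin_topspace) blast+
    then show ?thesis unfolding tY .
  qed
  have "\<exists>V\<in>\<B>. f \<in> V \<and> V \<subseteq> U" if U: "openin ?Y U" "f \<in> U" for U f
  proof -
    have fK: "f \<in> K" using U openin_subset tY by blast
    \<comment> \<open>Each half-space around \<open>f\<close> is replaced by its opposite at the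
      same threshold, which is disjoint from it. The opposites cover \<open>K - U\<close>, and a
      finite subcover yields a basic neighbourhood of \<open>f\<close> inside
      \<open>U\<close>.\<close>
    let ?\<W> = "{H (d, p, \<not> b) | d p b. d \<in> D \<and> f \<in> H (d, p, b)}"
    have "compactin ?Y (K - U)"
      using closedin_compact_space[OF compY closedin_diff[OF closedin_topspace U(1)]] unfolding tY .
    moreover have "\<forall>W\<in>?\<W>. openin ?Y W" using H unfolding I_def by auto
    moreover have "K - U \<subseteq> \<Union>?\<W>"
    proof
      fix g assume g: "g \<in> K - U"
      then obtain d where d: "d \<in> D" "f d \<noteq> g d" using sep[OF fK, of g] U(2) by blast
      show "g \<in> \<Union>?\<W>"
      proof (cases "f d < g d")
        case True
        then obtain p where "f d < of_rat p" "of_rat p < g d" using of_rat_dense by blast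
        then have "f \<in> H (d, p, True)" "g \<in> H (d, p, \<not> True)" using fK g unfolding H_def by auto
        then show ?thesis using d by blast
      next
        case False
        then have "g d < f d" using d by simp
        then obtain p where "g d < of_rat p" "of_rat p < f d" using of_rat_dense by blast
        then have "f \<in> H (d, p, False)" "g \<in> H (d, p, \<not> False)" using fK g unfolding H_def by auto
        then show ?thesis using d by blast
      qed
    qed
    ultimately obtain \<F> where \<F>: "finite \<F>" "\<F> \<subseteq> ?\<W>" "K - U \<subseteq> \<Union>\<F>"
      unfolding compactin_def by meson
    have "\<forall>W\<in>\<F>. \<exists>i\<in>I. f \<in> H i \<and> H i \<inter> W = {}"
    proof
      fix W assume "W \<in> \<F>"
      then obtain d p b where W: "W = H (d, p, \<not> b)" "d \<in> D" "f \<in> H (d, p, b)" using \<F> by blast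
      moreover have "H (d, p, b) \<inter> H (d, p, \<not> b) = {}" unfolding H_def by auto
      ultimately show "\<exists>i\<in>I. f \<in> H i \<and> H i \<inter> W = {}" unfolding I_def by blast
    qed
    then have "\<forall>W\<in>\<F>. \<exists>i. i \<in> I \<and> f \<in> H i \<and> H i \<inter> W = {}" by blast
    from bchoice[OF this] obtain j
      where j: "\<forall>W\<in>\<F>. j W \<in> I \<and> f \<in> H (j W) \<and> H (j W) \<inter> W = {}" ..
    have "j ` \<F> \<in> Fpow I" using j \<F>(1) unfolding Fpow_def by auto
    moreover have "f \<in> K \<inter> (\<Inter>i\<in>j ` \<F>. H i)" using fK j by simp
    moreover have "K \<inter> (\<Inter>i\<in>j ` \<F>. H i) \<subseteq> U"
    proof
      fix h assume h: "h \<in> K \<inter> (\<Inter>i\<in>j ` \<F>. H i)"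
      then have "h \<notin> W" if "W \<in> \<F>" for W using j that by auto
      then show "h \<in> U" using h \<F>(3) by blast
    qed
    ultimately show ?thesis unfolding \<B>_def by (intro bexI[OF _ imageI]) simp_all
  qed
  moreover have "\<forall>V\<in>\<B>. openin ?Y V" unfolding \<B>_def using opI by simp
  ultimately have "is_base ?Y \<B>" unfolding is_base_def by simp
  moreover have "|I| \<le>o \<kappa>"
    unfolding I_def by (intro Times_ordLeq_Cinfinite card inf countable_ordLeq_Cinfinite) auto
  then have "|\<B>| \<le>o \<kappa>"
    unfolding \<B>_def using Fpow_ordLeq_Cinfinite inf card_of_image ordLeq_transitive by blast
  ultimately show ?thesis by (rule weight_le)
qed

section \<open>The upper bound\<close>

text \<open>The family is an open cover of the subspace formed by its union, whose Lindelof number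
  is at most \<kappa>.\<close>

lemma hereditary_Lindelof_subfamily:
  assumes hl: "hereditary_Lindelof_number X \<le>o \<kappa>" and G: "\<And>G. G \<in> \<G> \<Longrightarrow> openin X G"
  obtains \<V> where "\<V> \<subseteq> \<G>" "|\<V>| \<le>o \<kappa>" "\<Union>\<V> = \<Union>\<G>"
proof -
  let ?Z = "\<Union>\<G>" and ?L = "Lindelof_number (subtopology X (\<Union>\<G>))"
  have Z: "?Z \<subseteq> topspace X" "openin X ?Z" using G openin_subset by blast+
  have top: "topspace (subtopology X ?Z) = ?Z" using Z by auto
  have "\<forall>U\<in>\<G>. openin (subtopology X ?Z) U"
    using G Z(2) by (auto simp: openin_open_subtopology)
  then have "\<exists>\<V>. \<V> \<subseteq> \<G> \<and> |\<V>| \<le>o ?L \<and> \<Union>\<V> = ?Z"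
    using Lindelof_number_least[of "subtopology X ?Z"] unfolding is_card_Least_def top by simp
  moreover have "?L \<le>o hereditary_Lindelof_number X"
    using hereditary_Lindelof_number_least[of X] Z(1) unfolding is_card_Least_def by blast
  ultimately show ?thesis using that hl ordLeq_transitive by meson
qed

lemma hereditary_density_subset:
  assumes hd: "hereditary_density X \<le>o \<kappa>" and Z: "Z \<subseteq> topspace X"
  obtains D where "D \<subseteq> Z" "|D| \<le>o \<kappa>" "Z \<subseteq> X closure_of D"
proof -
  let ?d = "density (subtopology X Z)"
  have top: "topspace (subtopology X Z) = Z" using Z by auto
  obtain D where D: "D \<subseteq> Z" "subtopology X Z closure_of D = Z" "|D| =o ?d"
    using density_least[of "subtopology X Z"] unfolding is_card_Least_def top by blast
  have "Z \<subseteq> X closure_of D"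
    using D(2) closure_of_subtopology_subset[of X Z D] by blast
  moreover have "?d \<le>o hereditary_density X"
    using hereditary_density_least[of X] Z unfolding is_card_Least_def by blast
  then have "|D| \<le>o \<kappa>"
    using ordIso_ordLeq_trans[OF D(3)] hd ordLeq_transitive by blast
  ultimately show ?thesis using that D(1) by blast
qed

text \<open>Only continuity at \<open>x\<close> relative to \<open>A\<close> is available, so one
  point \<open>d\<close> of \<open>D\<close> close to \<open>x\<close> for both functions is
  compared with \<open>x\<close>.\<close>

lemma eq_on_dense:
  assumes A: "A \<subseteq> topspace X" and x: "x \<in> A" "x \<in> X closure_of D" and D: "D \<subseteq> A"
    and f: "\<And>e. e > 0 \<Longrightarrow> x \<notin> jump X A f e" and g: "\<And>e. e > 0 \<Longrightarrow> x \<notin> jump X A g e"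
    and eq: "\<forall>d\<in>D. f d = g d"
  shows "f x = g x"
proof (rule ccontr)
  assume "f x \<noteq> g x"
  define e where "e = \<bar>f x - g x\<bar> / 2"
  then have e: "e > 0" using \<open>f x \<noteq> g x\<close> by simp
  obtain U where U: "openin X U" "x \<in> U" "\<forall>y\<in>A \<inter> U. \<bar>f y - f x\<bar> < e"
    using not_mem_jumpE[OF A x(1) f[OF e]] by blast
  obtain V where V: "openin X V" "x \<in> V" "\<forall>y\<in>A \<inter> V. \<bar>g y - g x\<bar> < e"
    using not_mem_jumpE[OF A x(1) g[OF e]] by blast
  have "openin X (U \<inter> V)" "x \<in> U \<inter> V" using U V by auto
  then obtain d where d: "d \<in> D" "d \<in> U" "d \<in> V" using x(2) unfolding in_closure_of by blast
  then have "\<bar>f d - f x\<bar> < e" "\<bar>g d - g x\<bar> < e" "f d = g d" using U V D eq by blast+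
  moreover from this(3) have "\<bar>f x - g x\<bar> \<le> \<bar>f d - f x\<bar> + \<bar>g d - g x\<bar>" by linarith
  ultimately show False unfolding e_def by argo
qed

text \<open>An exhaustion argument: by the Lindelof property the union \<open>?W\<close> of all open
  sets on whose trace in \<open>S\<close> at most \<kappa> points determine \<open>K\<close> has
  this property too. If it missed part of \<open>S\<close>, a piece of common continuity would
  enlarge it.\<close>

lemma bounded_determining:
  assumes ct: "countable_tightness X"
    and hl: "hereditary_Lindelof_number X \<le>o \<kappa>" and hd: "hereditary_density X \<le>o \<kappa>"
    and inf: "Cinfinite \<kappa>"
    and comp: "compactin (powertop_real (topspace X)) K" and conv: "convex_funs (topspace X) K"
    and SC: "\<And>f. f \<in> K \<Longrightarrow> scatteredly_continuous X euclideanreal f"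
    and S: "S \<subseteq> topspace X" and bound: "\<forall>f\<in>K. \<forall>x\<in>S. \<bar>f x\<bar> \<le> C"
  shows "\<exists>D. determining K D S \<and> |D| \<le>o \<kappa>"
proof -
  define \<G> where "\<G> = {G. openin X G \<and> (\<exists>D. determining K D (S \<inter> G) \<and> |D| \<le>o \<kappa>)}"
  obtain \<V> where \<V>: "\<V> \<subseteq> \<G>" "|\<V>| \<le>o \<kappa>" "\<Union>\<V> = \<Union>\<G>"
    using hereditary_Lindelof_subfamily[OF hl, of \<G>] unfolding \<G>_def by blast
  let ?W = "\<Union>\<G>"
  have W: "openin X ?W" unfolding \<G>_def by blast
  have "\<forall>V\<in>\<V>. \<exists>D. determining K D (S \<inter> V) \<and> |D| \<le>o \<kappa>" using \<V>(1) unfolding \<G>_def by blast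
  from bchoice[OF this] obtain D where D: "\<forall>V\<in>\<V>. determining K (D V) (S \<inter> V) \<and> |D V| \<le>o \<kappa>" ..
  let ?D = "\<Union>V\<in>\<V>. D V"
  have "determining K ?D (\<Union>V\<in>\<V>. S \<inter> V)" using D by (intro determining_UN) blast
  moreover have "(\<Union>V\<in>\<V>. S \<inter> V) = S \<inter> ?W" using \<V>(3) by blast
  ultimately have DW: "determining K ?D (S \<inter> ?W)" by simp
  have cardD: "|?D| \<le>o \<kappa>" using D by (intro UNION_Cinfinite_bound \<V>(2) inf) blast
  have "S \<subseteq> ?W"
  proof (rule ccontr)
    assume "\<not> S \<subseteq> ?W"
    define A where "A = S - ?W"
    have A: "A \<subseteq> topspace X" "A \<noteq> {}" using S \<open>\<not> S \<subseteq> ?W\<close> unfolding A_def by blast+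
    have "\<forall>f\<in>K. \<forall>x\<in>A. \<bar>f x\<bar> \<le> C" using bound unfolding A_def by blast
    from common_continuity_piece[OF ct A comp conv SC this]
    obtain U where U: "openin X U" "A \<inter> U \<noteq> {}"
      "\<And>f a e. f \<in> K \<Longrightarrow> a \<in> A \<inter> U \<Longrightarrow> e > 0 \<Longrightarrow> a \<notin> jump X A f e" by metis
    have "A \<inter> U \<subseteq> topspace X" using A by blast
    then obtain E where E: "E \<subseteq> A \<inter> U" "|E| \<le>o \<kappa>" "A \<inter> U \<subseteq> X closure_of E"
      using hereditary_density_subset[OF hd] by metis
    have "determining K E (A \<inter> U)"
      unfolding determining_def
    proof (intro conjI ballI impI E(1))
      fix f g x assume fg: "f \<in> K" "g \<in> K" "\<forall>x\<in>E. f x = g x" and x: "x \<in> A \<inter> U"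
      show "f x = g x"
        by (rule eq_on_dense[OF A(1), of x E]) (use x E fg U(3) in auto)
    qed
    from determining_Un[OF DW this] have "determining K (?D \<union> E) ((S \<inter> ?W) \<union> (A \<inter> U))" .
    \<comment> \<open>Continuity on the piece holds relative to \<open>A\<close> only, but points of
      \<open>S \<inter> U\<close> outside \<open>A\<close> lie in \<open>?W\<close> and are already
      determined.\<close>
    moreover have "(S \<inter> ?W) \<union> (A \<inter> U) = S \<inter> (?W \<union> U)" unfolding A_def by blast
    moreover have "|?D \<union> E| \<le>o \<kappa>" by (intro Un_Cinfinite_bound cardD E(2) inf)
    moreover have "openin X (?W \<union> U)" using W U(1) by blast
    ultimately have "?W \<union> U \<in> \<G>" unfolding \<G>_def by auto
    then have "U \<subseteq> ?W" by blast
    then show False using U(2) unfolding A_def by blast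
  qed
  then have "S \<inter> ?W = S" by blast
  then show ?thesis using DW cardD by auto
qed

lemma compactin_pointwise_bounded:
  assumes "compactin (powertop_real S) K" "x \<in> S"
  obtains n :: nat where "\<forall>f\<in>K. \<bar>f x\<bar> \<le> real n"
proof -
  have "continuous_map (powertop_real S) euclideanreal (\<lambda>f. f x)"
    by (rule continuous_map_product_projection[OF assms(2)])
  then have "compactin euclideanreal ((\<lambda>f. f x) ` K)" by (rule image_compactin[OF assms(1)])
  then have "bounded ((\<lambda>f. f x) ` K)" by (simp add: compact_imp_bounded)
  then obtain B where B: "\<forall>f\<in>K. \<bar>f x\<bar> \<le> B" by (auto simp: bounded_iff)
  obtain n :: nat where "B \<le> real n" using real_arch_simple by blast
  then have "\<forall>f\<in>K. \<bar>f x\<bar> \<le> real n" using B by fastforce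
  then show ?thesis by (rule that)
qed

lemma compact_convex_SC_D:
  assumes "compact_convex_SC X K"
  shows "compactin (powertop_real (topspace X)) K" "convex_funs (topspace X) K"
    "K \<subseteq> extensional (topspace X)" "\<And>f. f \<in> K \<Longrightarrow> scatteredly_continuous X euclideanreal f"
    "subtopology (SC_p X) K = subtopology (powertop_real (topspace X)) K"
proof -
  have K: "K \<subseteq> {f \<in> extensional (topspace X). scatteredly_continuous X euclideanreal f}"
    "compactin (powertop_real (topspace X)) K"
    using assms unfolding compact_convex_SC_def SC_p_def compactin_subtopology by auto
  then show "subtopology (SC_p X) K = subtopology (powertop_real (topspace X)) K"
    unfolding SC_p_def by (simp add: subtopology_subtopology Int_absorb1)
qed (use assms in \<open>auto simp: compact_convex_SC_def SC_p_def compactin_subtopology\<close>)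

text \<open>The convexity argument needs a uniform bound on the functions, so it is applied on each
  of the sets where the compact, hence pointwise bounded, set \<open>K\<close> is bounded by \<open>n\<close>.\<close>

lemma weight_compact_convex_le:
  assumes ct: "countable_tightness X"
    and hl: "hereditary_Lindelof_number X \<le>o \<kappa>" and hd: "hereditary_density X \<le>o \<kappa>"
    and inf: "Cinfinite \<kappa>" and K: "compact_convex_SC X K"
  shows "weight (subtopology (SC_p X) K) \<le>o \<kappa>"
proof -
  note KD = compact_convex_SC_D[OF K]
  define S where "S n = {x \<in> topspace X. \<forall>f\<in>K. \<bar>f x\<bar> \<le> real n}" for n :: nat
  have "\<forall>n. \<exists>D. determining K D (S n) \<and> |D| \<le>o \<kappa>"
    by (intro allI bounded_determining[OF ct hl hd inf KD(1,2,4)]) (auto simp: S_def)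
  from choice[OF this] obtain D where D: "\<forall>n. determining K (D n) (S n) \<and> |D n| \<le>o \<kappa>" ..
  let ?D = "\<Union>n. D n"
  have "determining K ?D (\<Union>n. S n)" by (rule determining_UN) (use D in simp)
  moreover have "(\<Union>n. S n) = topspace X"
  proof
    show "topspace X \<subseteq> (\<Union>n. S n)"
    proof
      fix x assume x: "x \<in> topspace X"
      then obtain n :: nat where "\<forall>f\<in>K. \<bar>f x\<bar> \<le> real n" by (rule compactin_pointwise_bounded[OF KD(1)])
      then show "x \<in> (\<Union>n. S n)" using x unfolding S_def by blast
    qed
  qed (auto simp: S_def)
  ultimately have det: "determining K ?D (topspace X)" by simp
  have "|?D| \<le>o \<kappa>"
  proof (rule UNION_Cinfinite_bound[OF _ _ inf])
    show "|UNIV :: nat set| \<le>o \<kappa>" by (rule countable_ordLeq_Cinfinite[OF _ inf]) simp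
  qed (use D in simp)
  \<comment> \<open>Agreement on \<open>topspace X\<close> is equality, as members of
    \<open>K\<close> are extensional.\<close>
  have sep: "f = g" if fg: "f \<in> K" "g \<in> K" "\<forall>x\<in>?D. f x = g x" for f g
  proof (rule extensionalityI)
    show "f x = g x" if "x \<in> topspace X" for x
      by (rule determiningD[OF det fg that])
  qed (use fg KD(3) in auto)
  have sub: "?D \<subseteq> topspace X" using det unfolding determining_def by (rule conjunct1)
  show ?thesis
    unfolding KD(5) by (rule compact_separated_weight_le[OF KD(1) sub sep \<open>|?D| \<le>o \<kappa>\<close> inf])
qed

section \<open>The lower bound\<close>

text \<open>Composition with \<open>r\<close> identifies this with the Tychonoff cube having one
  coordinate for each value of \<open>r\<close> on \<open>topspace X\<close>.\<close>

definition fibre_cube :: "'a topology \<Rightarrow> ('a \<Rightarrow> 'b) \<Rightarrow> ('a \<Rightarrow> real) set" where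
  "fibre_cube X r = {f \<in> topspace X \<rightarrow>\<^sub>E {0..1}.
     \<forall>x\<in>topspace X. \<forall>y\<in>topspace X. r x = r y \<longrightarrow> f x = f y}"

lemma fibre_cubeD:
  assumes f: "f \<in> fibre_cube X r" and x: "x \<in> topspace X"
  shows "0 \<le> f x" "f x \<le> 1" "\<And>y. y \<in> topspace X \<Longrightarrow> r x = r y \<Longrightarrow> f x = f y"
proof -
  have "f \<in> topspace X \<rightarrow>\<^sub>E {0..1}" using f unfolding fibre_cube_def by blast
  from PiE_mem[OF this x] show "0 \<le> f x" "f x \<le> 1" by simp_all
  show "f x = f y" if "y \<in> topspace X" "r x = r y" for y
    using f x that unfolding fibre_cube_def by blast
qed

text \<open>This is scattered continuity of \<open>r\<close> for the discrete topology on its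
  codomain.\<close>

definition scatteredly_constant :: "'a topology \<Rightarrow> ('a \<Rightarrow> 'b) \<Rightarrow> bool" where
  "scatteredly_constant X r \<longleftrightarrow> (\<forall>A. A \<subseteq> topspace X \<and> A \<noteq> {} \<longrightarrow>
     (\<exists>a\<in>A. \<exists>U. openin X U \<and> a \<in> U \<and> (\<forall>x\<in>A \<inter> U. r x = r a)))"

lemma compactin_fibre_cube: "compactin (powertop_real (topspace X)) (fibre_cube X r)"
proof -
  let ?T = "topspace X" and ?P = "powertop_real (topspace X)"
  define E where "E p = {f \<in> topspace ?P. f (fst p) - f (snd p) \<in> {0}}" for p :: "'a \<times> 'a"
  have mem_E: "f \<in> E p \<longleftrightarrow> f \<in> topspace ?P \<and> f (fst p) = f (snd p)" for f p
    by (simp add: E_def)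
  let ?I = "{p \<in> ?T \<times> ?T. r (fst p) = r (snd p)}"
  have "closedin ?P (E p)" if "p \<in> ?I" for p
    unfolding E_def
    by (rule closedin_continuous_map_preimage[of _ euclideanreal])
      (use that in \<open>auto intro!: continuous_map_diff continuous_map_product_projection\<close>)
  then have "closedin ?P C" if "C \<in> insert (topspace ?P) (E ` ?I)" for C
    using that closedin_topspace[of ?P] by (elim insertE imageE) simp_all
  \<comment> \<open>The whole space is inserted to keep the family non-empty when \<open>X\<close>
    is empty.\<close>
  then have "closedin ?P (\<Inter>(insert (topspace ?P) (E ` ?I)))" by (rule closedin_Inter[OF insert_not_empty])
  moreover have "compactin ?P (?T \<rightarrow>\<^sub>E {0..1})" by (simp add: compactin_PiE)
  ultimately have "compactin ?P (\<Inter>(insert (topspace ?P) (E ` ?I)) \<inter> (?T \<rightarrow>\<^sub>E {0..1}))"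
    by (rule closed_Int_compactin)
  also have "\<Inter>(insert (topspace ?P) (E ` ?I)) \<inter> (?T \<rightarrow>\<^sub>E {0..1}) = fibre_cube X r"
  proof (intro subset_antisym subsetI)
    fix f assume f: "f \<in> \<Inter>(insert (topspace ?P) (E ` ?I)) \<inter> (?T \<rightarrow>\<^sub>E {0..1})"
    have "f x = f y" if "x \<in> ?T" "y \<in> ?T" "r x = r y" for x y
    proof -
      have "(x, y) \<in> ?I" using that by simp
      then have "f \<in> E (x, y)" using f by blast
      then show ?thesis by (simp add: mem_E)
    qed
    then show "f \<in> fibre_cube X r" using f unfolding fibre_cube_def by blast
  next
    fix f assume f: "f \<in> fibre_cube X r"
    then have cube: "f \<in> ?T \<rightarrow>\<^sub>E {0..1}" unfolding fibre_cube_def by blast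
    then have top: "f \<in> topspace ?P" by (simp add: PiE_iff)
    have "f \<in> E p" if "p \<in> ?I" for p
    proof -
      have "f (fst p) = f (snd p)" using f that unfolding fibre_cube_def mem_Times_iff by blast
      then show ?thesis using top by (simp add: mem_E)
    qed
    then show "f \<in> \<Inter>(insert (topspace ?P) (E ` ?I)) \<inter> (?T \<rightarrow>\<^sub>E {0..1})"
      using cube top by blast
  qed
  finally show ?thesis .
qed

text \<open>A function that factors through \<open>r\<close> is constant wherever \<open>r\<close>
  is, so it is continuous at the points supplied by \<open>scatteredly_constant\<close>.\<close>

lemma compact_convex_fibre_cube:
  assumes r: "scatteredly_constant X r"
  shows "compact_convex_SC X (fibre_cube X r)"
proof -
  have "scatteredly_continuous X euclideanreal f" if f: "f \<in> fibre_cube X r" for f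
    unfolding scatteredly_continuous_iff_jump
  proof (intro allI impI)
    fix A assume A: "A \<subseteq> topspace X \<and> A \<noteq> {}"
    then obtain a U where a: "a \<in> A" "openin X U" "a \<in> U" "\<forall>x\<in>A \<inter> U. r x = r a"
      using r unfolding scatteredly_constant_def by meson
    then have eq: "\<forall>x\<in>A \<inter> U. f x = f a" using f A unfolding fibre_cube_def by blast
    have "a \<notin> jump X A f e" if "e > 0" for e
    proof
      assume "a \<in> jump X A f e"
      then obtain x where x: "x \<in> A \<inter> U" "e \<le> \<bar>f x - f a\<bar>"
        using a(2,3) unfolding mem_jump_iff[OF conjunct1[OF A]] by blast
      have "f x = f a" using eq x(1) by (rule bspec)
      then show False using x(2) that by simp
    qed
    then show "\<exists>a\<in>A. \<forall>e>0. a \<notin> jump X A f e" using a(1) by blast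
  qed
  moreover have "fibre_cube X r \<subseteq> extensional (topspace X)"
    unfolding fibre_cube_def PiE_def by blast
  moreover have "convex_funs (topspace X) (fibre_cube X r)"
    unfolding convex_funs_def
  proof (intro ballI allI impI)
    fix f g and u v :: real
    assume fg: "f \<in> fibre_cube X r" "g \<in> fibre_cube X r" and uv: "u \<ge> 0" "v \<ge> 0" "u + v = 1"
    have range: "u * f x + v * g x \<in> {0..1}" if x: "x \<in> topspace X" for x
    proof -
      note b = fibre_cubeD[OF fg(1) x] fibre_cubeD[OF fg(2) x]
      have "u * f x + v * g x \<le> u * 1 + v * 1"
        by (intro add_mono mult_left_mono b uv)
      moreover have "0 \<le> u * f x + v * g x" by (intro add_nonneg_nonneg mult_nonneg_nonneg b uv)
      ultimately show ?thesis using uv(3) by simp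
    qed
    have eq: "u * f x + v * g x = u * f y + v * g y"
      if "x \<in> topspace X" "y \<in> topspace X" "r x = r y" for x y
      using fibre_cubeD(3)[OF fg(1) that] fibre_cubeD(3)[OF fg(2) that] by simp
    show "(\<lambda>x\<in>topspace X. u * f x + v * g x) \<in> fibre_cube X r" (is "?h \<in> _")
      unfolding fibre_cube_def
    proof (intro CollectI conjI ballI impI)
      show "?h \<in> topspace X \<rightarrow>\<^sub>E {0..1}" using range by (intro PiE_I) simp_all
      fix x y assume xy: "x \<in> topspace X" "y \<in> topspace X" "r x = r y"
      show "?h x = ?h y" using eq[OF xy] xy(1,2) by simp
    qed
  qed
  moreover have "compactin (powertop_real (topspace X)) (fibre_cube X r)"
    by (rule compactin_fibre_cube)
  ultimately show ?thesis
    unfolding compact_convex_SC_def SC_p_def compactin_subtopology by blast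
qed

text \<open>Choose a basic set between \<open>e i\<close> and \<open>N i\<close>: if two indices
  shared it, each point would lie in the neighbourhood of the other.\<close>

lemma card_le_weight:
  assumes N: "\<And>i. i \<in> I \<Longrightarrow> openin Y (N i) \<and> e i \<in> N i"
    and sep: "\<And>i j. i \<in> I \<Longrightarrow> j \<in> I \<Longrightarrow> e i \<in> N j \<Longrightarrow> e j \<in> N i \<Longrightarrow> i = j"
  shows "|I| \<le>o weight Y"
proof -
  obtain \<B> where \<B>: "is_base Y \<B>" "|\<B>| =o weight Y" by (rule weight_base)
  have "\<exists>V. V \<in> \<B> \<and> e i \<in> V \<and> V \<subseteq> N i" if "i \<in> I" for i
    using N[OF that] \<B>(1) unfolding is_base_def by blast
  then have "\<forall>i\<in>I. \<exists>V. V \<in> \<B> \<and> e i \<in> V \<and> V \<subseteq> N i" by (rule ballI)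
  from bchoice[OF this] obtain V where V: "\<forall>i\<in>I. V i \<in> \<B> \<and> e i \<in> V i \<and> V i \<subseteq> N i" ..
  have "inj_on V I"
  proof (rule inj_onI)
    fix i j assume ij: "i \<in> I" "j \<in> I" "V i = V j"
    then have "e i \<in> N j" "e j \<in> N i" using V by blast+
    then show "i = j" by (rule sep[OF ij(1,2)])
  qed
  moreover have "V ` I \<subseteq> \<B>" using V by blast
  ultimately have "|I| \<le>o |\<B>|" unfolding card_of_ordLeq[symmetric] by blast
  then show ?thesis using \<B>(2) ordLeq_ordIso_trans by blast
qed

lemma openin_eval_greater:
  assumes "compact_convex_SC X K" "x \<in> topspace X"
  shows "openin (subtopology (SC_p X) K) {f \<in> K. f x > c}"
proof -
  note KD = compact_convex_SC_D[OF assms(1)]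
  have K: "K \<subseteq> topspace (powertop_real (topspace X))" using KD(1) compactin_subset_topspace by blast
  have "openin (subtopology (SC_p X) K) {f \<in> topspace (subtopology (SC_p X) K). f x \<in> {c<..}}"
    unfolding KD(5)
    by (rule openin_continuous_map_preimage[OF continuous_map_eval[OF K assms(2)]]) simp
  moreover have "topspace (subtopology (SC_p X) K) = K" unfolding KD(5) using K by auto
  ultimately show ?thesis by (simp only: greaterThan_iff)
qed

text \<open>The indicators of the fibres form a discrete subset of the cube: evaluation at a chosen
  point of a fibre isolates its indicator.\<close>

lemma card_fibres_le_weight:
  "scatteredly_constant X r \<Longrightarrow>
    |r ` topspace X| \<le>o weight (subtopology (SC_p X) (fibre_cube X r))"
proof -
  assume r: "scatteredly_constant X r"
  let ?T = "topspace X"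
  let ?e = "\<lambda>c. (\<lambda>x\<in>?T. if r x = c then 1 else 0 :: real)"
  let ?x = "inv_into ?T r"
  have x: "?x c \<in> ?T" "r (?x c) = c" if "c \<in> r ` ?T" for c
    using that by (auto intro: inv_into_into f_inv_into_f)
  show ?thesis
  proof (rule card_le_weight)
    fix c assume c: "c \<in> r ` ?T"
    have "?e c \<in> fibre_cube X r"
      unfolding fibre_cube_def
    proof (intro CollectI conjI ballI impI)
      show "?e c \<in> ?T \<rightarrow>\<^sub>E {0..1}" by (intro PiE_I) simp_all
    qed simp
    moreover have "?e c (?x c) > 1/2" using x[OF c] by simp
    moreover have "openin (subtopology (SC_p X) (fibre_cube X r)) {f \<in> fibre_cube X r. f (?x c) > 1/2}"
      by (rule openin_eval_greater[OF compact_convex_fibre_cube[OF r] x(1)[OF c]])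
    ultimately show "openin (subtopology (SC_p X) (fibre_cube X r)) {f \<in> fibre_cube X r. f (?x c) > 1/2} \<and>
        ?e c \<in> {f \<in> fibre_cube X r. f (?x c) > 1/2}"
      by blast
  next
    fix c d assume c: "c \<in> r ` ?T" "d \<in> r ` ?T" "?e c \<in> {f \<in> fibre_cube X r. f (?x d) > 1/2}"
    then have "?e c (?x d) > 1/2" by blast
    then have "(if r (?x d) = c then 1 else 0 :: real) > 1/2"
      unfolding restrict_apply'[OF x(1)[OF c(2)]] .
    then show "c = d" unfolding x(2)[OF c(2)] by (simp split: if_splits)
  qed
qed

text \<open>Lindelof numbers are infinite by definition, so the supremum of weights must be shown
  infinite as well; constant functions suffice once there is a point to evaluate at.\<close>

lemma infinite_weight_constants:
  assumes x: "x \<in> topspace X"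
  shows "|UNIV :: nat set| \<le>o weight (subtopology (SC_p X) (fibre_cube X (\<lambda>_. ())))"
proof -
  let ?K = "fibre_cube X (\<lambda>_. ())"
  have "scatteredly_constant X (\<lambda>_. ())" unfolding scatteredly_constant_def by blast
  then have K: "compact_convex_SC X ?K" by (rule compact_convex_fibre_cube)
  let ?e = "\<lambda>n::nat. (\<lambda>x\<in>topspace X. inverse (real (Suc n)))"
  let ?O = "\<lambda>n::nat. {f \<in> ?K. f x > inverse (real (Suc (Suc n)))}"
  \<comment> \<open>The thresholds are shifted by one so that each constant lies in its own set;
    mutual membership then forces equal indices by antisymmetry.\<close>
  have mem: "?e n \<in> ?O m \<longleftrightarrow> n \<le> m" for n m
  proof -
    have "?e n \<in> ?K"
      unfolding fibre_cube_def
    proof (intro CollectI conjI ballI impI)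
      show "?e n \<in> topspace X \<rightarrow>\<^sub>E {0..1}" by (intro PiE_I) (simp_all add: divide_simps)
    qed simp
    then have "?e n \<in> ?O m \<longleftrightarrow> inverse (real (Suc n)) > inverse (real (Suc (Suc m)))" using x by simp
    also have "\<dots> \<longleftrightarrow> Suc n < Suc (Suc m)"
      by (subst inverse_less_iff_less) (simp_all only: of_nat_less_iff of_nat_0_less_iff zero_less_Suc)
    finally show ?thesis by (simp only: less_Suc_eq_le Suc_le_mono)
  qed
  show ?thesis
  proof (rule card_le_weight[of _ _ ?O ?e])
    show "openin (subtopology (SC_p X) ?K) (?O n) \<and> ?e n \<in> ?O n" for n
      using openin_eval_greater[OF K x] mem[of n n] by blast
    show "i = j" if "?e i \<in> ?O j" "?e j \<in> ?O i" for i j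
      using that unfolding mem by simp
  qed
qed

lemma scatteredly_constant_cover:
  assumes G: "\<And>G. G \<in> \<G> \<Longrightarrow> openin X G"
  obtains r :: "'a \<Rightarrow> 'a set option" where "scatteredly_constant X r"
    "\<And>x. x \<in> \<Union>\<G> \<Longrightarrow> \<exists>G\<in>\<G>. x \<in> G \<and> r x = Some G"
proof -
  obtain W :: "'a set rel" where W: "well_order_on UNIV W" using well_order_on by blast
  define R where "R = W - Id"
  have "wf R" using W unfolding R_def well_order_on_def by (rule conjunct2)
  then have min: "\<exists>M\<in>\<Q>. \<forall>N. (N, M) \<in> R \<longrightarrow> N \<notin> \<Q>" if "M0 \<in> \<Q>" for M0 \<Q>
    using that unfolding wf_eq_minimal by (elim allE impE)
  have tot: "M = N \<or> (M, N) \<in> R \<or> (N, M) \<in> R" for M N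
    using W unfolding R_def well_order_on_def linear_order_on_def total_on_def by blast
  have "\<forall>x\<in>\<Union>\<G>. \<exists>M. M \<in> \<G> \<and> x \<in> M \<and> (\<forall>N. (N, M) \<in> R \<longrightarrow> \<not> (N \<in> \<G> \<and> x \<in> N))"
  proof
    fix x assume "x \<in> \<Union>\<G>"
    then obtain M0 where "M0 \<in> {M \<in> \<G>. x \<in> M}" by blast
    from min[OF this] show "\<exists>M. M \<in> \<G> \<and> x \<in> M \<and> (\<forall>N. (N, M) \<in> R \<longrightarrow> \<not> (N \<in> \<G> \<and> x \<in> N))" by blast
  qed
  from bchoice[OF this] obtain m
    where m: "\<forall>x\<in>\<Union>\<G>. m x \<in> \<G> \<and> x \<in> m x \<and> (\<forall>N. (N, m x) \<in> R \<longrightarrow> \<not> (N \<in> \<G> \<and> x \<in> N))" ..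
  \<comment> \<open>Points outside the union share the extra value \<open>None\<close>.\<close>
  define r where "r x = (if x \<in> \<Union>\<G> then Some (m x) else None)" for x
  have "scatteredly_constant X r"
    unfolding scatteredly_constant_def
  proof (intro allI impI)
    fix A assume A: "A \<subseteq> topspace X \<and> A \<noteq> {}"
    show "\<exists>a\<in>A. \<exists>U. openin X U \<and> a \<in> U \<and> (\<forall>x\<in>A \<inter> U. r x = r a)"
    proof (cases "A \<inter> \<Union>\<G> = {}")
      case True
      then have "\<forall>x\<in>A. r x = None" unfolding r_def by auto
      moreover obtain a where "a \<in> A" using A by blast
      ultimately show ?thesis using A by (intro bexI[of _ a] exI[of _ "topspace X"]) auto
    next
      case False
      then obtain a0 where "m a0 \<in> m ` (A \<inter> \<Union>\<G>)" by blast
      from min[OF this] obtain a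
        where a: "a \<in> A" "a \<in> \<Union>\<G>" "\<forall>N. (N, m a) \<in> R \<longrightarrow> N \<notin> m ` (A \<inter> \<Union>\<G>)" by blast
      have ma: "m a \<in> \<G>" "a \<in> m a" using m a(2) by blast+
      have "r x = r a" if x: "x \<in> A" "x \<in> m a" for x
      proof -
        have xG: "x \<in> \<Union>\<G>" using x(2) ma(1) by blast
        \<comment> \<open>As \<open>m a\<close> contains \<open>x\<close>, the least choice
          \<open>m x\<close> cannot exceed it; minimality of \<open>m a\<close> over
          \<open>A\<close> excludes a smaller one.\<close>
        then have "(m a, m x) \<notin> R" using m ma(1) x(2) by blast
        moreover have "(m x, m a) \<notin> R" using a(3) x(1) xG by blast
        ultimately have "m x = m a" using tot by blast
        then show ?thesis using xG a(2) unfolding r_def by simp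
      qed
      then show ?thesis using a(1) ma G by blast
    qed
  qed
  moreover have "\<exists>G\<in>\<G>. x \<in> G \<and> r x = Some G" if x: "x \<in> \<Union>\<G>" for x
  proof (intro bexI conjI)
    show "r x = Some (m x)" using x unfolding r_def by (rule if_P)
    show "x \<in> m x" "m x \<in> \<G>" using bspec[OF m x] by blast+
  qed
  ultimately show ?thesis by (rule that)
qed

section \<open>From weights to the hereditary Lindelof number\<close>

lemma Lindelof_number_le:
  fixes X :: "'a topology" and \<kappa> :: "'a cardinal"
  assumes \<kappa>: "Card_order \<kappa>" "cinfinite \<kappa>"
    and cover: "\<And>\<U>. \<forall>U\<in>\<U>. openin X U \<Longrightarrow> \<Union>\<U> = topspace X \<Longrightarrow>
      \<exists>\<V>. \<V> \<subseteq> \<U> \<and> |\<V>| \<le>o \<kappa> \<and> \<Union>\<V> = topspace X"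
  shows "Lindelof_number X \<le>o \<kappa>"
proof -
  have "\<forall>\<U>. (\<forall>U\<in>\<U>. openin X U) \<and> \<Union>\<U> = topspace X \<longrightarrow>
      (\<exists>\<V>. \<V> \<subseteq> \<U> \<and> |\<V>| \<le>o \<kappa> \<and> \<Union>\<V> = topspace X)"
    by (intro allI impI, elim conjE) (rule cover)
  with \<kappa>(2) have "cinfinite \<kappa> \<and> (\<forall>\<U>. (\<forall>U\<in>\<U>. openin X U) \<and> \<Union>\<U> = topspace X \<longrightarrow>
      (\<exists>\<V>. \<V> \<subseteq> \<U> \<and> |\<V>| \<le>o \<kappa> \<and> \<Union>\<V> = topspace X))" by (rule conjI)
  from is_card_Least_le[OF Lindelof_number_least \<kappa>(1) this] show ?thesis .
qed

text \<open>The bound \<sigma> may live on a type too large for direct comparison. Arguing by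
  contradiction makes it smaller than the hereditary Lindelof number, so it has a copy \<tau> on
  that type.\<close>

lemma hereditary_Lindelof_number_le:
  fixes \<sigma> :: "'b rel"
  assumes ne: "topspace X \<noteq> {}" and \<sigma>: "Card_order \<sigma>"
    and weight: "\<And>K. compact_convex_SC X K \<Longrightarrow> weight (subtopology (SC_p X) K) \<le>o \<sigma>"
  shows "hereditary_Lindelof_number X \<le>o \<sigma>"
proof (rule ccontr)
  let ?hl = "hereditary_Lindelof_number X"
  have hl: "Card_order ?hl"
    "\<And>s :: 'a cardinal. Card_order s \<Longrightarrow>
      (\<And>Z. Z \<subseteq> topspace X \<Longrightarrow> Lindelof_number (subtopology X Z) \<le>o s) \<Longrightarrow> ?hl \<le>o s"
    using hereditary_Lindelof_number_least[of X] unfolding is_card_Least_def by blast+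
  obtain x where "x \<in> topspace X" using ne by blast
  have "scatteredly_constant X (\<lambda>_. ())" unfolding scatteredly_constant_def by blast
  from ordLeq_transitive[OF infinite_weight_constants[OF \<open>x \<in> topspace X\<close>]
      weight[OF compact_convex_fibre_cube[OF this]]]
  have nat: "|UNIV :: nat set| \<le>o \<sigma>" .
  have cover: "\<exists>\<V>. \<V> \<subseteq> \<G> \<and> |\<V>| \<le>o \<sigma> \<and> \<Union>\<V> = \<Union>\<G>" if G: "\<forall>G\<in>\<G>. openin X G" for \<G>
  proof -
    obtain r :: "'a \<Rightarrow> 'a set option" where r: "scatteredly_constant X r"
      "\<And>x. x \<in> \<Union>\<G> \<Longrightarrow> \<exists>G\<in>\<G>. x \<in> G \<and> r x = Some G"
      using scatteredly_constant_cover[of \<G> X] G by metis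
    \<comment> \<open>The selected members still cover the union, and there are at most as many as
      values of \<open>r\<close>.\<close>
    let ?\<V> = "(\<lambda>x. the (r x)) ` \<Union>\<G>"
    have "\<Union>\<G> \<subseteq> topspace X" using G openin_subset by blast
    then have "?\<V> \<subseteq> the ` r ` topspace X" by blast
    then have "|?\<V>| \<le>o |r ` topspace X|"
      by (rule ordLeq_transitive[OF card_of_mono1 card_of_image])
    also have "|r ` topspace X| \<le>o \<sigma>"
      using card_fibres_le_weight[OF r(1)] weight[OF compact_convex_fibre_cube[OF r(1)]]
      by (rule ordLeq_transitive)
    finally (ordLeq_transitive) have "|?\<V>| \<le>o \<sigma>" .
    moreover have the_r: "the (r x) \<in> \<G>" "x \<in> the (r x)" if "x \<in> \<Union>\<G>" for x
      using r(2)[OF that] by (elim bexE conjE, simp)+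
    have "?\<V> \<subseteq> \<G>" using the_r(1) by (rule image_subsetI)
    moreover have "\<Union>?\<V> = \<Union>\<G>"
    proof
      show "\<Union>?\<V> \<subseteq> \<Union>\<G>" using \<open>?\<V> \<subseteq> \<G>\<close> by (rule Union_mono)
      show "\<Union>\<G> \<subseteq> \<Union>?\<V>" using the_r(2) by blast
    qed
    ultimately show ?thesis by (intro exI[of _ ?\<V>] conjI)
  qed
  assume "\<not> ?hl \<le>o \<sigma>"
  then have less: "\<sigma> <o ?hl"
    using not_ordLeq_iff_ordLess[OF card_order_on_well_order_on[OF \<sigma>] card_order_on_well_order_on[OF hl(1)]]
    by simp
  have "|Field \<sigma>| \<le>o ?hl"
    using ordIso_ordLeq_trans[OF card_of_Field_ordIso[OF \<sigma>] ordLess_imp_ordLeq[OF less]] .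
  then have "|Field \<sigma>| \<le>o |UNIV :: ('a set + nat) set|"
    using Card_order_ordLeq_UNIV[OF hl(1)] by (rule ordLeq_transitive)
  then obtain \<tau> :: "'a cardinal" where \<tau>: "Card_order \<tau>" "|Field \<sigma>| =o \<tau>"
    using ordIso_cardinal_exists by blast
  have \<sigma>\<tau>: "\<sigma> =o \<tau>"
    using ordIso_transitive[OF ordIso_symmetric[OF card_of_Field_ordIso[OF \<sigma>]] \<tau>(2)] .
  have "cinfinite |UNIV :: nat set|" by (simp add: cinfinite_def Field_card_of)
  then have "cinfinite \<tau>" by (rule cinfinite_mono[OF ordLeq_ordIso_trans[OF nat \<sigma>\<tau>]])
  have "Lindelof_number (subtopology X Z) \<le>o \<tau>" if Z: "Z \<subseteq> topspace X" for Z
  proof -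
    have "\<exists>\<V>. \<V> \<subseteq> \<U> \<and> |\<V>| \<le>o \<tau> \<and> \<Union>\<V> = topspace (subtopology X Z)"
      if U: "\<forall>U\<in>\<U>. openin (subtopology X Z) U" "\<Union>\<U> = topspace (subtopology X Z)" for \<U>
    proof -
      \<comment> \<open>The relative cover is lifted to open sets of \<open>X\<close>, thinned out
        there, and traced back to \<open>Z\<close>.\<close>
      have "\<forall>U\<in>\<U>. \<exists>G. openin X G \<and> U = G \<inter> Z" using U(1) unfolding openin_subtopology by blast
      from bchoice[OF this] obtain g where g: "\<forall>U\<in>\<U>. openin X (g U) \<and> U = g U \<inter> Z" ..
      then have "\<forall>G\<in>g ` \<U>. openin X G" by blast
      from cover[OF this] obtain \<V> where \<V>: "\<V> \<subseteq> g ` \<U>" "|\<V>| \<le>o \<sigma>" "\<Union>\<V> = \<Union>(g ` \<U>)" by blast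
      let ?\<V> = "(\<lambda>G. G \<inter> Z) ` \<V>"
      have "?\<V> \<subseteq> \<U>"
      proof (rule image_subsetI)
        fix G assume "G \<in> \<V>"
        then obtain U where U: "U \<in> \<U>" "G = g U" using \<V>(1) by blast
        then have "U = G \<inter> Z" using g by blast
        then show "G \<inter> Z \<in> \<U>" using U(1) by simp
      qed
      moreover have "|?\<V>| \<le>o \<tau>"
        by (rule ordLeq_ordIso_trans[OF ordLeq_transitive[OF card_of_image \<V>(2)] \<sigma>\<tau>])
      moreover have "\<Union>?\<V> = \<Union>\<U>"
      proof -
        have "\<Union>?\<V> = \<Union>(g ` \<U>) \<inter> Z" using \<V>(3) by blast
        also have "\<dots> = (\<Union>U\<in>\<U>. g U \<inter> Z)" by blast
        also have "\<dots> = (\<Union>U\<in>\<U>. U)" using g by (intro SUP_cong) simp_all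
        finally show ?thesis by simp
      qed
      ultimately show ?thesis unfolding U(2)[symmetric] by (intro exI[of _ ?\<V>] conjI)
    qed
    then show ?thesis by (rule Lindelof_number_le[OF \<tau>(1) \<open>cinfinite \<tau>\<close>])
  qed
  with \<tau>(1) have "?hl \<le>o \<tau>" by (rule hl(2))
  then have "?hl \<le>o \<sigma>" by (rule ordLeq_ordIso_trans[OF _ ordIso_symmetric[OF \<sigma>\<tau>]])
  then show False using \<open>\<not> ?hl \<le>o \<sigma>\<close> by blast
qed

text \<open>Even the empty subspace has an infinite Lindelof number.\<close>

lemma cinfinite_hereditary_Lindelof_number: "cinfinite (hereditary_Lindelof_number X)"
proof -
  have "Lindelof_number (subtopology X {}) \<le>o hereditary_Lindelof_number X"
    using hereditary_Lindelof_number_least[of X] unfolding is_card_Least_def by blast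
  moreover have "cinfinite (Lindelof_number (subtopology X {}))"
    using Lindelof_number_least[of "subtopology X {}"] unfolding is_card_Least_def by blast
  ultimately show ?thesis by (rule cinfinite_mono)
qed

theorem corollary2:
  fixes X :: "'a topology"
  assumes "countable_tightness X"
  shows "(\<forall>K. compact_convex_SC X K \<longrightarrow>
            weight (subtopology (SC_p X) K)
              \<le>o card_max (hereditary_Lindelof_number X) (hereditary_density X)) \<and>
         (topspace X \<noteq> {} \<longrightarrow>
            hereditary_Lindelof_number X
              \<le>o card_Sup {weight (subtopology (SC_p X) K) | K. compact_convex_SC X K}) \<and>
         card_Sup {weight (subtopology (SC_p X) K) | K. compact_convex_SC X K}
           \<le>o card_max (hereditary_Lindelof_number X) (hereditary_density X)"
proof -
  let ?hl = "hereditary_Lindelof_number X" and ?hd = "hereditary_density X"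
  let ?R = "{weight (subtopology (SC_p X) K) | K. compact_convex_SC X K}"
  have "Card_order ?hl" "Card_order ?hd"
    using hereditary_Lindelof_number_least[of X] hereditary_density_least[of X]
    unfolding is_card_Least_def by blast+
  note max = card_max_upper[OF this]
  have "Cinfinite (card_max ?hl ?hd)"
    using cinfinite_mono[OF max(2) cinfinite_hereditary_Lindelof_number] max(1) by blast
  then have upper: "weight (subtopology (SC_p X) K) \<le>o card_max ?hl ?hd"
    if "compact_convex_SC X K" for K
    using weight_compact_convex_le[OF assms max(2,3)] that by blast
  have "card_Sup ?R \<le>o card_max ?hl ?hd"
  proof (rule card_Sup_le[OF _ max(1) cardinal_type_le_fun])
    fix r assume "r \<in> ?R"
    then show "Card_order r \<and> r \<le>o card_max ?hl ?hd"
      using upper weight_least unfolding is_card_Least_def by blast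
  qed
  moreover have "?hl \<le>o card_Sup ?R" if "topspace X \<noteq> {}"
  proof (rule hereditary_Lindelof_number_le[OF that])
    show "Card_order (card_Sup ?R)"
      using sup_weight_compact_convex_least[of X] unfolding is_card_Least_def by blast
    show "weight (subtopology (SC_p X) K) \<le>o card_Sup ?R" if "compact_convex_SC X K" for K
      using sup_weight_compact_convex_least[of X] that unfolding is_card_Least_def by blast
  qed
  ultimately show ?thesis using upper by blast
qed

end
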